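(* Let $(\tilde M^{n+p},\tilde F)$ be a Randers manifold with navigation data $(\tilde h,\tilde W)$, where $\tilde W$ is a Killing vector field of $\tilde h$, and let $f:M^n\to(\tilde M^{n+p},\tilde F)$ be a submanifold isometrically immersed, locally given by $\tilde x^\alpha=f^\alpha(x^1,\dots,x^n)$. Then the BH-mean curvature form (resp. the HT-mean curvature form) $\mathcal H_f=\mathcal H_\gamma d\tilde x^\gamma$ of $f$ is given by \begin{align*} \mathcal H_\gamma={}&\frac{2(\log\chi)'}{\varrho}\Big[2\varrho' B^{\eta\delta}\tilde W_\delta\tilde W_\tau(\delta^\tau_\gamma-B^\tau_\gamma)-\varrho(\delta^\eta_\gamma-B^\eta_\gamma)\Big]\tilde W_{\alpha|\eta}\tilde W^\alpha\\ &-\frac1{\varrho}\Big\{4\varrho'B^{\eta\beta}\tilde W_{\alpha|\eta}\tilde W_\beta(\delta^\alpha_\gamma-B^\alpha_\gamma)-2\Big[2\varrho''B^{\eta\delta}\tilde W_\delta\tilde W_\tau(\delta^\tau_\gamma-B^\tau_\gamma)-\varrho'(\delta^\eta_\gamma-B^\eta_\gamma)\Big]\tilde W_{\alpha|\eta}\tilde W^\alpha\Big\}\\ &-\frac1{\varrho}\Big\{h^{ij}\Big[2\varrho'\tilde W_\alpha\tilde W_\beta(\delta^\beta_\gamma-B^\beta_\gamma)+\varrho\tilde h_{\gamma\alpha}\Big]+2\tilde W_\delta\tilde W_\tau A^{i\delta}A^{j\tau}\Big[2\varrho''\tilde W_\alpha\tilde W_\beta(\delta^\beta_\gamma-B^\beta_\gamma)-\varrho'\tilde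 h_{\gamma\alpha}\Big]\Big\}\tau^\alpha_{ij}. \end{align*}
   Context: Navigation data: $\tilde h$ is a Riemannian metric on $\tilde M$ and $\tilde W$ a vector field with $\|\tilde W\|_{\tilde h}<1$; the Randers metric is $\tilde F(\tilde x,y)=\big(\sqrt{\lambda\,\tilde h(y,y)+\tilde h(\tilde W,y)^2}-\tilde h(\tilde W,y)\big)/\lambda$ with $\lambda=1-\|\tilde W\|^2_{\tilde h}$; $M$ carries the induced metric $f^*\tilde F$. Index ranges $1\le i,j,k\le n$, $1\le\alpha,\beta,\gamma,\eta,\delta,\tau\le n+p$, summation convention. Notation: $z^\alpha_i=\partial f^\alpha/\partial x^i$, $\tilde W_\alpha=\tilde h_{\alpha\beta}\tilde W^\beta$, $h_{ij}=\tilde h_{\alpha\beta}z^\alpha_iz^\beta_j$, $(h^{ij})=(h_{ij})^{-1}$, $W_i=\tilde W_\alpha z^\alpha_i$, $\|W\|^2_h=h^{ij}W_iW_j$, $\mathfrak s=1-\|\tilde W\|^2_{\tilde h}+\|W\|^2_h$, $A^{i\alpha}=h^{ij}z^\alpha_j$, $B^{\alpha\beta}=h^{ij}z^\alpha_iz^\beta_j$, $B^\alpha_\beta=B^{\alpha\delta}\tilde h_{\delta\beta}$. $\tilde W^\beta_{|\eta}$ are the components of $\nabla^{\tilde h}\tilde W$, $\tilde W_{\alpha|\eta}=\tilde h_{\alpha\beta}\tilde W^\beta_{|\eta}$. $\tau^\alpha_{ij}=\frac{\partial^2f^\alpha}{\partial x^i\partial x^j}+\tilde\Gamma^\alpha_{\tau\delta}z^\tau_jz^\delta_i-\Gamma^k_{ij}z^\alpha_k$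 is the second fundamental form of $f:(M,h)\to(\tilde M,\tilde h)$. Volume data: $(\varrho,\chi)=(\mathfrak s^{-n/2},1)$ in the Busemann–Hausdorff (BH) case and $(\varrho,\chi)=(\mathfrak s^{1/2},(1-\|\tilde W\|^2_{\tilde h})^{(n+1)/2})$ in the Holmes–Thompson (HT) case; $\varrho',\varrho''$ are derivatives in $\mathfrak s$; $(\log\chi)'$ is the derivative of $\log\chi$ with respect to $\|\tilde W\|^2_{\tilde h}$. With $\mathcal F=\frac{\varrho(\mathfrak s)}{\chi}\sqrt{\det(h_{ij})}$ viewed as a function of $\tilde x$ and $z=(z^\alpha_i)$, the mean curvature form is defined by $\mathcal H_\gamma=\frac1{\mathcal F}\Big\{\frac{\partial\mathcal F}{\partial\tilde x^\gamma}-\frac{\partial^2\mathcal F}{\partial z^\gamma_i\partial z^\eta_j}\frac{\partial^2 f^\eta}{\partial x^i\partial x^j}-\frac{\partial^2\mathcal F}{\partial\tilde x^\eta\partial z^\gamma_i}\frac{\partial f^\eta}{\partial x^i}\Big\}$. *)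

theory Defs
  imports "HOL-Analysis.Analysis"
begin

(* Local-coordinate setting: M^n is an open set U in R^n (index type 'n),
   tilde M^{n+p} an open set V in R^{n+p} (index type 'm).  Vectors real^'n,
   real^'m; a matrix z = (z^alpha_i) is real^'n^'m with z$alpha$i. *)

definition pd :: "('a::real_normed_vector \<Rightarrow> real) \<Rightarrow> 'a \<Rightarrow> 'a \<Rightarrow> real" where
  "pd g v a = deriv (\<lambda>t. g (a + t *\<^sub>R v)) 0"

fun iter_pd :: "('a::real_normed_vector \<Rightarrow> real) \<Rightarrow> 'a list \<Rightarrow> 'a \<Rightarrow> real" where
  "iter_pd g [] = g"
| "iter_pd g (v # vs) = pd (iter_pd g vs) v"

definition smooth_on :: "('a::real_normed_vector) set \<Rightarrow> ('a \<Rightarrow> real) \<Rightarrow> bool" where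
  "smooth_on S g \<longleftrightarrow> open S \<and> (\<forall>vs. iter_pd g vs differentiable_on S)"

definition kd :: "'i \<Rightarrow> 'i \<Rightarrow> real" where
  "kd a b = (if a = b then 1 else 0)"

definition dx :: "(real^'k \<Rightarrow> real) \<Rightarrow> 'k::finite \<Rightarrow> real^'k \<Rightarrow> real" where
  "dx g k a = pd g (axis k 1) a"

definition christoffel :: "(real^'k \<Rightarrow> real^'k^'k) \<Rightarrow> real^'k \<Rightarrow> 'k::finite \<Rightarrow> 'k \<Rightarrow> 'k \<Rightarrow> real" where
  "christoffel g y a b c = (1/2) * (\<Sum>d\<in>UNIV. matrix_inv (g y) $ a $ d *
      (dx (\<lambda>u. g u $ d $ c) b y + dx (\<lambda>u. g u $ d $ b) c y - dx (\<lambda>u. g u $ b $ c) d y))"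

definition riemannian_on :: "(real^'k) set \<Rightarrow> (real^'k \<Rightarrow> real^'k^'k) \<Rightarrow> bool" where
  "riemannian_on V g \<longleftrightarrow> (\<forall>a b. smooth_on V (\<lambda>y. g y $ a $ b)) \<and>
     (\<forall>y\<in>V. (\<forall>a b. g y $ a $ b = g y $ b $ a) \<and>
        (\<forall>v. v \<noteq> 0 \<longrightarrow> (\<Sum>a\<in>UNIV. \<Sum>b\<in>UNIV. g y $ a $ b * v $ a * v $ b) > 0))"

definition nrm2 :: "(real^'k \<Rightarrow> real^'k^'k) \<Rightarrow> (real^'k \<Rightarrow> real^'k) \<Rightarrow> real^'k \<Rightarrow> real" where
  "nrm2 g W y = (\<Sum>a\<in>UNIV. \<Sum>b\<in>UNIV. g y $ a $ b * W y $ a * W y $ b)"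

definition lowW :: "(real^'k \<Rightarrow> real^'k^'k) \<Rightarrow> (real^'k \<Rightarrow> real^'k) \<Rightarrow> real^'k \<Rightarrow> 'k::finite \<Rightarrow> real" where
  "lowW g W y a = (\<Sum>b\<in>UNIV. g y $ a $ b * W y $ b)"

(* Killing vector field: Lie derivative of g along W vanishes *)
definition killing_on :: "(real^'k) set \<Rightarrow> (real^'k \<Rightarrow> real^'k^'k) \<Rightarrow> (real^'k \<Rightarrow> real^'k) \<Rightarrow> bool" where
  "killing_on V g W \<longleftrightarrow> (\<forall>y\<in>V. \<forall>a b.
     (\<Sum>d\<in>UNIV. W y $ d * dx (\<lambda>u. g u $ a $ b) d y
        + g y $ d $ b * dx (\<lambda>u. W u $ d) a y + g y $ a $ d * dx (\<lambda>u. W u $ d) b y) = 0)"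

definition covW :: "(real^'k \<Rightarrow> real^'k^'k) \<Rightarrow> (real^'k \<Rightarrow> real^'k) \<Rightarrow> real^'k \<Rightarrow> 'k::finite \<Rightarrow> 'k \<Rightarrow> real" where
  "covW g W y b e = dx (\<lambda>u. W u $ b) e y + (\<Sum>d\<in>UNIV. christoffel g y b e d * W y $ d)"

definition covWl :: "(real^'k \<Rightarrow> real^'k^'k) \<Rightarrow> (real^'k \<Rightarrow> real^'k) \<Rightarrow> real^'k \<Rightarrow> 'k::finite \<Rightarrow> 'k \<Rightarrow> real" where
  "covWl g W y a e = (\<Sum>b\<in>UNIV. g y $ a $ b * covW g W y b e)"

definition hmat :: "real^'m^'m \<Rightarrow> real^'n^'m \<Rightarrow> real^'n^'n" where
  "hmat G z = (\<chi> i j. \<Sum>a\<in>UNIV. \<Sum>b\<in>UNIV. G $ a $ b * z $ a $ i * z $ b $ j)"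

definition frak_s :: "(real^'m \<Rightarrow> real^'m^'m) \<Rightarrow> (real^'m \<Rightarrow> real^'m) \<Rightarrow> real^'m \<Rightarrow> real^'n^'m \<Rightarrow> real" where
  "frak_s g W y z = 1 - nrm2 g W y +
     (\<Sum>i\<in>UNIV. \<Sum>j\<in>UNIV. matrix_inv (hmat (g y) z) $ i $ j *
        (\<Sum>a\<in>UNIV. lowW g W y a * z $ a $ i) * (\<Sum>a\<in>UNIV. lowW g W y a * z $ a $ j))"

datatype volform = BH | HT

(* rho as function of s, chi as function of w = |W~|^2, n = dim M *)
definition rho :: "volform \<Rightarrow> nat \<Rightarrow> real \<Rightarrow> real" where
  "rho vt n s = (case vt of BH \<Rightarrow> s powr (- (real n / 2)) | HT \<Rightarrow> s powr (1/2))"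

definition chi :: "volform \<Rightarrow> nat \<Rightarrow> real \<Rightarrow> real" where
  "chi vt n w = (case vt of BH \<Rightarrow> 1 | HT \<Rightarrow> (1 - w) powr ((real n + 1) / 2))"

definition Fcal :: "volform \<Rightarrow> (real^'m \<Rightarrow> real^'m^'m) \<Rightarrow> (real^'m \<Rightarrow> real^'m) \<Rightarrow>
     (real^'m) \<times> (real^'n::finite^'m::finite) \<Rightarrow> real" where
  "Fcal vt g W q = rho vt CARD('n) (frak_s g W (fst q) (snd q)) / chi vt CARD('n) (nrm2 g W (fst q))
      * sqrt (det (hmat (g (fst q)) (snd q)))"

definition dirX :: "'m \<Rightarrow> (real^'m::finite) \<times> (real^'n::finite^'m)" where
  "dirX c = (axis c 1, 0)"
definition dirZ :: "'m \<Rightarrow> 'n \<Rightarrow> (real^'m::finite) \<times> (real^'n::finite^'m)" where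
  "dirZ c i = (0, axis c (axis i 1))"

definition Dfz :: "(real^'n \<Rightarrow> real^'m) \<Rightarrow> real^'n::finite \<Rightarrow> real^'n^'m::finite" where
  "Dfz f x = (\<chi> a i. dx (\<lambda>u. f u $ a) i x)"

definition d2f :: "(real^'n \<Rightarrow> real^'m) \<Rightarrow> real^'n::finite \<Rightarrow> 'm::finite \<Rightarrow> 'n \<Rightarrow> 'n \<Rightarrow> real" where
  "d2f f x a i j = dx (\<lambda>u. dx (\<lambda>v. f v $ a) j u) i x"

definition meancurv :: "volform \<Rightarrow> (real^'m \<Rightarrow> real^'m^'m) \<Rightarrow> (real^'m \<Rightarrow> real^'m) \<Rightarrow>
    (real^'n \<Rightarrow> real^'m) \<Rightarrow> real^'n::finite \<Rightarrow> 'm::finite \<Rightarrow> real" where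
  "meancurv vt g W f x c = (let F = Fcal vt g W; q = (f x, Dfz f x) in
     (1 / F q) * (pd F (dirX c) q
       - (\<Sum>i\<in>UNIV. \<Sum>j\<in>UNIV. \<Sum>e\<in>UNIV. pd (\<lambda>r. pd F (dirZ e j) r) (dirZ c i) q * d2f f x e i j)
       - (\<Sum>i\<in>UNIV. \<Sum>e\<in>UNIV. pd (\<lambda>r. pd F (dirZ c i) r) (dirX e) q * Dfz f x $ e $ i)))"

definition sff :: "(real^'m \<Rightarrow> real^'m^'m) \<Rightarrow> (real^'n \<Rightarrow> real^'m) \<Rightarrow> real^'n::finite \<Rightarrow> 'm::finite \<Rightarrow> 'n \<Rightarrow> 'n \<Rightarrow> real" where
  "sff g f x a i j = d2f f x a i j
     + (\<Sum>t\<in>UNIV. \<Sum>d\<in>UNIV. christoffel g (f x) a t d * Dfz f x $ t $ j * Dfz f x $ d $ i)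
     - (\<Sum>k\<in>UNIV. christoffel (\<lambda>u. hmat (g (f u)) (Dfz f u)) x k i j * Dfz f x $ a $ k)"

definition rhs :: "volform \<Rightarrow> (real^'m \<Rightarrow> real^'m^'m) \<Rightarrow> (real^'m \<Rightarrow> real^'m) \<Rightarrow>
    (real^'n \<Rightarrow> real^'m) \<Rightarrow> real^'n::finite \<Rightarrow> 'm::finite \<Rightarrow> real" where
  "rhs vt g W f x c = (let
      n = CARD('n); y = f x; z = Dfz f x; G = g y;
      hi = matrix_inv (hmat G z);
      s = frak_s g W y z;
      r0 = rho vt n s; r1 = deriv (rho vt n) s; r2 = deriv (deriv (rho vt n)) s;
      L = deriv (\<lambda>w. ln (chi vt n w)) (nrm2 g W y);
      Wu = (\<lambda>a. W y $ a); Wl = lowW g W y; Wc = covWl g W y;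
      A = (\<lambda>i a. \<Sum>j\<in>UNIV. hi $ i $ j * z $ a $ j);
      B = (\<lambda>a b. \<Sum>i\<in>UNIV. \<Sum>j\<in>UNIV. hi $ i $ j * z $ a $ i * z $ b $ j);
      Bm = (\<lambda>a b. \<Sum>d\<in>UNIV. B a d * G $ d $ b);
      P = (\<lambda>a b. kd a b - Bm a b);
      Q = (\<lambda>u v e. 2 * u * (\<Sum>d\<in>UNIV. \<Sum>t\<in>UNIV. B e d * Wl d * Wl t * P t c) - v * P e c);
      K = (\<lambda>u v. \<Sum>e\<in>UNIV. \<Sum>a\<in>UNIV. Q u v e * Wc a e * Wu a);
      T = (\<lambda>a i j. hi $ i $ j * (2 * r1 * Wl a * (\<Sum>b\<in>UNIV. Wl b * P b c) + r0 * G $ c $ a)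
            + 2 * (\<Sum>d\<in>UNIV. \<Sum>t\<in>UNIV. Wl d * Wl t * A i d * A j t)
                * (2 * r2 * Wl a * (\<Sum>b\<in>UNIV. Wl b * P b c) - r1 * G $ c $ a))
    in 2 * L / r0 * K r1 r0
       - (1 / r0) * (4 * r1 * (\<Sum>e\<in>UNIV. \<Sum>b\<in>UNIV. \<Sum>a\<in>UNIV. B e b * Wc a e * Wl b * P a c)
                     - 2 * K r2 r1)
       - (1 / r0) * (\<Sum>i\<in>UNIV. \<Sum>j\<in>UNIV. \<Sum>a\<in>UNIV. T a i j * sff g f x a i j))"

end

theory Submission
  imports Defs
begin

text \<open>
  Write $h = z^T G z$, $A = h^{-1} z^T$, $B = z A$, $P = 1 - B G$, and let p be the lowered field.
  The integrand is a function of the metric G, the covector p, the squared norm w and the matrix z,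
  so its first and second variations along any curve in these variables are explicit matrix expressions
  built from $A G$, $A p$ and $P^T p$.  The integrand is invariant under the simultaneous action of
  GL(m) on (G, p, z); infinitesimally, this turns coordinate derivatives in the ambient space
  into covariant ones, and every ambient Christoffel symbol is absorbed into the second fundamental form.
  Reparametrisation invariance makes the Christoffel symbols of the induced metric contribute zero.
  The formula then follows because the second fundamental form is symmetric
  and normal (Gauss formula) and because $\nabla W$ is skew for a Killing field.
\<close>

text \<open>The last two terms of H form the total derivative of dF/dz^c_i along x^i, so H is an
  Euler-Lagrange expression whose single terms are not covariant. The inner derivative is always a
  fibre derivative, hence only \<open>first_var\<close> has to be varied again. Its velocity along
  the i-th parameter line is a sum of four pieces: the orbit direction generated by M_i = sum over e
  of z^e_i \<Gamma>_e; the direction (0, R z_i, \<omega>.z_i, 0), where R is the covariant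
  derivative of the lowered field and \<omega> the gradient of its squared norm; the second
  fundamental form \<tau>_i; and z K_i, where K_i is the Christoffel matrix of the induced metric.
  The second variation is linear in the velocity, so each piece is evaluated alone. With E_i the
  matrix unit at (c,i), the orbit piece yields the first variation in direction M_i E_i, and the sum
  over i cancels the Christoffel part of dF/dx^c. Treating p and w as variables independent of G is
  what allows orbit directions with w-velocity 0 and confines the derivatives of the field to R and
  \<omega>.\<close>

declare transpose_matrix_vector [simp del] vector_transpose_matrix [simp del]

subsection \<open>Matrix calculus\<close>

lemma bounded_bilinear_matrix_mult:
  "bounded_bilinear ((**) :: real^'n^'m \<Rightarrow> real^'k^'n \<Rightarrow> real^'k^'m)"
  by (subst bilinear_conv_bounded_bilinear[symmetric])
    (auto simp: bilinear_def linear_iff matrix_matrix_mult_def vec_eq_iff sum.distrib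
      sum_distrib_left algebra_simps)

lemma bounded_bilinear_matrix_vector_mult:
  "bounded_bilinear ((*v) :: real^'n^'m \<Rightarrow> real^'n \<Rightarrow> real^'m)"
  by (subst bilinear_conv_bounded_bilinear[symmetric])
    (auto simp: bilinear_def linear_iff matrix_vector_mult_def vec_eq_iff sum.distrib
      sum_distrib_left algebra_simps)

lemma bounded_linear_transpose: "bounded_linear (transpose :: real^'n^'m \<Rightarrow> real^'m^'n)"
  by (subst linear_conv_bounded_linear[symmetric]) (auto simp: linear_iff transpose_def vec_eq_iff)

lemma bounded_linear_trace: "bounded_linear (trace :: real^'n^'n \<Rightarrow> real)"
  by (subst linear_conv_bounded_linear[symmetric])
    (auto simp: linear_iff trace_def sum.distrib sum_distrib_left)

lemmas matrix_mult_has_vector_derivative =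
  bounded_bilinear.has_vector_derivative[OF bounded_bilinear_matrix_mult]
lemmas matrix_vector_mult_has_vector_derivative =
  bounded_bilinear.has_vector_derivative[OF bounded_bilinear_matrix_vector_mult]
lemmas transpose_has_vector_derivative =
  bounded_linear.has_vector_derivative[OF bounded_linear_transpose]
lemmas trace_has_vector_derivative =
  bounded_linear.has_vector_derivative[OF bounded_linear_trace]
lemmas inner_has_vector_derivative =
  bounded_bilinear.has_vector_derivative[OF bounded_bilinear_inner]

lemmas matrix_left_distribs = bounded_bilinear.add_left[OF bounded_bilinear_matrix_mult]
  bounded_bilinear.diff_left[OF bounded_bilinear_matrix_mult]
  bounded_bilinear.minus_left[OF bounded_bilinear_matrix_mult]
  bounded_bilinear.zero_left[OF bounded_bilinear_matrix_mult]
lemmas matrix_right_distribs = bounded_bilinear.add_right[OF bounded_bilinear_matrix_mult]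
  bounded_bilinear.diff_right[OF bounded_bilinear_matrix_mult]
  bounded_bilinear.minus_right[OF bounded_bilinear_matrix_mult]
  bounded_bilinear.zero_right[OF bounded_bilinear_matrix_mult]
lemmas matrix_vector_left_distribs = bounded_bilinear.add_left[OF bounded_bilinear_matrix_vector_mult]
  bounded_bilinear.diff_left[OF bounded_bilinear_matrix_vector_mult]
  bounded_bilinear.minus_left[OF bounded_bilinear_matrix_vector_mult]
  bounded_bilinear.zero_left[OF bounded_bilinear_matrix_vector_mult]
lemmas matrix_vector_right_distribs = bounded_bilinear.add_right[OF bounded_bilinear_matrix_vector_mult]
  bounded_bilinear.diff_right[OF bounded_bilinear_matrix_vector_mult]
  bounded_bilinear.minus_right[OF bounded_bilinear_matrix_vector_mult]
  bounded_bilinear.zero_right[OF bounded_bilinear_matrix_vector_mult]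
lemmas transpose_distribs = 
  linear_add[OF bounded_linear.linear[OF bounded_linear_transpose]]
  linear_diff[OF bounded_linear.linear[OF bounded_linear_transpose]]
  linear_neg[OF bounded_linear.linear[OF bounded_linear_transpose]]
  linear_0[OF bounded_linear.linear[OF bounded_linear_transpose]]
lemmas trace_distribs = 
  linear_add[OF bounded_linear.linear[OF bounded_linear_trace]]
  linear_diff[OF bounded_linear.linear[OF bounded_linear_trace]]
  linear_neg[OF bounded_linear.linear[OF bounded_linear_trace]]
  linear_0[OF bounded_linear.linear[OF bounded_linear_trace]]

lemmas matrix_distribs = matrix_left_distribs matrix_right_distribs matrix_vector_left_distribs matrix_vector_right_distribs
  transpose_distribs trace_distribs matrix_transpose_mul

lemma inner_matrix_left: "(M *v x) \<bullet> y = x \<bullet> (transpose M *v y)" for M :: "real^'n^'m"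
  by (simp add: dot_lmul_matrix[symmetric] transpose_matrix_vector inner_commute)

lemma trace_transpose: "trace (transpose M) = trace M"
  by (simp add: trace_def transpose_def)

lemma symmetric_entries: "transpose M = M \<Longrightarrow> M $ a $ b = M $ b $ a"
  by (simp add: transpose_def vec_eq_iff)

lemma has_vector_derivative_componentwise:
  fixes f :: "real \<Rightarrow> 'a::real_normed_vector^'n"
  assumes "\<And>i. ((\<lambda>t. f t $ i) has_vector_derivative f' $ i) (at t)"
  shows "(f has_vector_derivative f') (at t)"
proof -
  have "((\<lambda>y. (f y - f t - (y - t) *\<^sub>R f') /\<^sub>R norm (y - t)) \<longlongrightarrow> 0) (at t)"
    using assms
    by (intro vec_tendstoI) (simp add: has_vector_derivative_def has_derivative_at_within)
  then show ?thesis
    by (simp add: has_vector_derivative_def has_derivative_at_within bounded_linear_scaleR_left)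
qed

lemma vec_nth_has_vector_derivative:
  assumes "(f has_vector_derivative f') F"
  shows "((\<lambda>t. f t $ i) has_vector_derivative f' $ i) F"
  using bounded_linear.has_vector_derivative[OF bounded_linear_vec_nth assms] by blast

subsection \<open>Determinant and inverse along a curve\<close>

text \<open>The Leibniz sum is a polynomial in the entries. Unlike
  \<open>det_has_derivative\<close>, this applies to singular matrices as well, such as the
  numerators in Cramer's rule.\<close>

lemma real_differentiable_det:
  fixes M :: "real \<Rightarrow> real^'n^'n"
  assumes "\<And>i j. (\<lambda>t. M t $ i $ j) differentiable (at t)"
  shows "(\<lambda>t. det (M t)) differentiable (at t)"
proof -
  obtain D where "\<And>i j. ((\<lambda>t. M t $ i $ j) has_derivative D i j) (at t)"
    using assms unfolding differentiable_def by metis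
  then have "(\<lambda>t. \<Prod>i\<in>UNIV. M t $ i $ p i) differentiable (at t)" for p
    by (rule differentiableI[OF has_derivative_prod])
  then show ?thesis
    unfolding det_def
    by (auto intro!: differentiable_sum differentiable_mult)
qed

lemma matrix_inv_mult:
  assumes "invertible M"
  shows matrix_inv_right: "M ** matrix_inv M = mat 1" and matrix_inv_left: "matrix_inv M ** M = mat 1"
  using someI_ex[OF assms[unfolded invertible_def]] unfolding matrix_inv_def by auto

text \<open>\<open>matrix_inv\<close> is a choice; writing its entries as quotients of determinants
  makes its differentiability accessible.\<close>

lemma matrix_inv_cramer:
  fixes M :: "real^'n^'n"
  assumes "invertible M"
  shows "matrix_inv M $ k $ l = det (\<chi> i j. if j = k then axis l 1 $ i else M $ i $ j) / det M"
proof -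
  have "M *v (matrix_inv M *v axis l 1) = axis l 1"
    using assms by (simp add: matrix_vector_mul_assoc matrix_inv_right)
  moreover have "det M \<noteq> 0"
    using assms invertible_det_nz by blast
  ultimately have "matrix_inv M *v axis l 1 = 
      (\<chi> k. det (\<chi> i j. if j = k then axis l 1 $ i else M $ i $ j) / det M)"
    by (simp add: cramer)
  then have "(matrix_inv M *v axis l 1) $ k = det (\<chi> i j. if j = k then axis l 1 $ i else M $ i $ j) / det M"
    by simp
  then show ?thesis
    by (simp add: matrix_vector_mult_basis column_def)
qed

text \<open>A permutation other than the identity moves at least two points, so after one factor of
  its Leibniz product is differentiated, an off-diagonal zero of \<open>mat 1\<close> remains. Only
  the identity contributes, and it gives the trace.\<close>

lemma det_has_derivative_at_identity:
  fixes M :: "real \<Rightarrow> real^'n^'n"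
  assumes M: "(M has_vector_derivative M') (at t)" and Mt: "M t = mat 1"
  shows "((\<lambda>t. det (M t)) has_real_derivative trace M') (at t)"
proof -
  have comp: "((\<lambda>t. M t $ i $ j) has_real_derivative M' $ i $ j) (at t)" for i j
    using vec_nth_has_vector_derivative[OF vec_nth_has_vector_derivative[OF M]]
    by (simp add: has_real_derivative_iff_has_vector_derivative)
  have "((\<lambda>t. det (M t)) has_real_derivative (\<Sum>p | p permutes UNIV. of_int (sign p) *
      (\<Sum>i\<in>UNIV. M' $ i $ p i * (\<Prod>j\<in>UNIV - {i}. M t $ j $ p j)))) (at t)"
    unfolding det_def
    by (rule DERIV_sum DERIV_cmult has_field_derivative_prod comp)+
  also have "(\<Sum>p | p permutes UNIV. of_int (sign p) *
      (\<Sum>i\<in>UNIV. M' $ i $ p i * (\<Prod>j\<in>UNIV - {i}. M t $ j $ p j))) =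
      (\<Sum>p | p permutes (UNIV :: 'n set). if p = id then trace M' else 0)"
  proof (intro sum.cong)
    fix p :: "'n \<Rightarrow> 'n" assume "p \<in> {p. p permutes UNIV}"
    then have p: "p permutes UNIV" by simp
    show "of_int (sign p) * (\<Sum>i\<in>UNIV. M' $ i $ p i * (\<Prod>j\<in>UNIV - {i}. M t $ j $ p j)) =
        (if p = id then trace M' else 0)"
    proof (cases "p = id")
      case True
      then show ?thesis by (simp add: Mt trace_def mat_def sign_id)
    next
      case False
      then obtain k where k: "p k \<noteq> k" by (metis eq_id_iff)
      have prod0: "(\<Prod>j\<in>UNIV - {i}. M t $ j $ p j) = 0" for i
      proof -
        have "\<exists>j\<in>UNIV - {i}. p j \<noteq> j"
        proof (cases "k = i")
          case True
          \<comment> \<open>If the moved point \<open>k\<close> is the differentiated index, then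
            \<open>p k\<close> is a second moved point, by injectivity.\<close>
          moreover have "p (p k) \<noteq> p k"
            using k permutes_inj[OF p] by (simp add: inj_eq)
          ultimately show ?thesis using k by blast
        qed (use k in blast)
        then have "\<exists>j\<in>UNIV - {i}. M t $ j $ p j = 0"
          by (metis (mono_tags, lifting) Mt mat_def vec_lambda_beta)
        then show ?thesis by (intro prod_zero) auto
      qed
      with False show ?thesis
        by (simp only: prod0 mult_zero_right sum.neutral_const if_False)
    qed
  qed simp
  also have "\<dots> = trace M'"
    by (simp add: sum.delta' finite_permutations permutes_id)
  finally show ?thesis .
qed

text \<open>Jacobi's formula: multiplying by the constant matrix \<open>matrix_inv (M t)\<close>
  moves the base point to the identity.\<close>

lemma det_has_derivative:
  fixes M :: "real \<Rightarrow> real^'n^'n"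
  assumes M: "(M has_vector_derivative M') (at t)" and inv: "invertible (M t)"
  shows "((\<lambda>t. det (M t)) has_real_derivative det (M t) * trace (matrix_inv (M t) ** M')) (at t)"
proof -
  let ?I = "matrix_inv (M t)"
  have "((\<lambda>s. ?I ** M s) has_vector_derivative ?I ** M') (at t)"
    using matrix_mult_has_vector_derivative[OF has_vector_derivative_const M, of ?I]
    by (simp add: matrix_left_distribs)
  then have "((\<lambda>s. det (?I ** M s)) has_real_derivative trace (?I ** M')) (at t)"
    by (rule det_has_derivative_at_identity) (simp add: inv matrix_inv_left)
  from DERIV_cmult[OF this, of "det (M t)"]
  have "((\<lambda>s. det (M t) * det (?I ** M s)) has_real_derivative det (M t) * trace (?I ** M')) (at t)" .
  moreover have "det (M t) * det (?I ** M s) = det (M s)" for s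
    by (metis det_mul inv matrix_inv_right matrix_mul_assoc matrix_mul_lid)
  ultimately show ?thesis by simp
qed

text \<open>Cramer's quotients show that a derivative exists; its value follows from differentiating
  the constant product of the inverse with \<open>M\<close>. Both arguments use that
  \<open>M s\<close> stays invertible for \<open>s\<close> near \<open>t\<close>.\<close>

lemma matrix_inv_has_vector_derivative:
  fixes M :: "real \<Rightarrow> real^'n^'n"
  assumes M: "(M has_vector_derivative M') (at t)" and inv: "invertible (M t)"
  shows "((\<lambda>t. matrix_inv (M t)) has_vector_derivative
    - (matrix_inv (M t) ** M' ** matrix_inv (M t))) (at t)"
proof -
  have comp: "(\<lambda>t. M t $ i $ j) differentiable (at t)" for i j
    using vec_nth_has_vector_derivative[OF vec_nth_has_vector_derivative[OF M]]
    by (rule differentiableI_vector)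
  have "isCont (\<lambda>t. det (M t)) t"
    by (intro differentiable_imp_continuous_within real_differentiable_det comp)
  moreover have dt: "det (M t) \<noteq> 0" using inv invertible_det_nz by blast
  ultimately have "eventually (\<lambda>s. det (M s) \<noteq> 0) (nhds t)"
    unfolding continuous_at
    by (simp add: eventually_nhds_conv_at tendsto_imp_eventually_ne)
  then have ev: "eventually (\<lambda>s. invertible (M s)) (nhds t)"
    by (simp add: invertible_det_nz)
  let ?J = "\<lambda>t. (\<chi> k l. det (\<chi> i j. if j = k then axis l 1 $ i else M t $ i $ j) / det (M t)) :: real^'n^'n"
  have evJ: "eventually (\<lambda>s. ?J s = matrix_inv (M s)) (nhds t)"
    using ev by eventually_elim (simp add: vec_eq_iff matrix_inv_cramer)
  define D where "D k l = vector_derivative (\<lambda>t. ?J t $ k $ l) (at t)" for k l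
  have D: "((\<lambda>t. ?J t $ k $ l) has_vector_derivative D k l) (at t)" for k l
  proof -
    have "(\<lambda>t. det (\<chi> i j. if j = k then axis l 1 $ i else M t $ i $ j)) differentiable (at t)"
      by (rule real_differentiable_det, case_tac "j = k") (use comp in auto)
    then have "(\<lambda>t. ?J t $ k $ l) differentiable (at t)"
      using real_differentiable_det[OF comp] dt by (simp add: differentiable_divide)
    then show ?thesis
      unfolding D_def by (rule vector_derivative_works[THEN iffD1])
  qed
  have "(?J has_vector_derivative (\<chi> k l. D k l)) (at t)"
    by (intro has_vector_derivative_componentwise) (use D in simp)
  then have J: "((\<lambda>t. matrix_inv (M t)) has_vector_derivative (\<chi> k l. D k l)) (at t)"
    using has_vector_derivative_cong_ev[of UNIV ?J "\<lambda>t. matrix_inv (M t)" t]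
      eventually_nhds_x_imp_x[OF evJ] evJ by simp
  have "((\<lambda>t. matrix_inv (M t) ** M t) has_vector_derivative
      matrix_inv (M t) ** M' + (\<chi> k l. D k l) ** M t) (at t)"
    by (rule matrix_mult_has_vector_derivative[OF J M])
  moreover have "((\<lambda>t. matrix_inv (M t) ** M t) has_vector_derivative 0) (at t)"
  proof -
    have "eventually (\<lambda>s. s \<in> UNIV \<longrightarrow> mat 1 = matrix_inv (M s) ** M s) (nhds t)"
      using ev by eventually_elim (simp only: matrix_inv_left simp_thms)
    from has_vector_derivative_cong_ev[OF this matrix_inv_left[OF inv, symmetric]]
    show ?thesis
      using has_vector_derivative_const by blast
  qed
  ultimately have "matrix_inv (M t) ** M' + (\<chi> k l. D k l) ** M t = 0"
    using vector_derivative_unique_at by blast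
  then have "(\<chi> k l. D k l) ** M t = - (matrix_inv (M t) ** M')"
    by (metis add_eq_0_iff)
  then have "(\<chi> k l. D k l) ** M t ** matrix_inv (M t) = - (matrix_inv (M t) ** M') ** matrix_inv (M t)"
    by simp
  then have "(\<chi> k l. D k l) = - (matrix_inv (M t) ** M' ** matrix_inv (M t))"
    by (simp add: matrix_left_distribs matrix_mul_assoc[symmetric] matrix_inv_right inv)
  with J show ?thesis by simp
qed

subsection \<open>Tangential and normal parts\<close>

lemma hmat_eq: "hmat G z = transpose z ** G ** z"
proof -
  have "(\<Sum>a\<in>UNIV. \<Sum>b\<in>UNIV. G $ a $ b * z $ a $ i * z $ b $ j) =
    (\<Sum>b\<in>UNIV. (\<Sum>a\<in>UNIV. z $ a $ i * G $ a $ b) * z $ b $ j)" for i j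
    by (subst sum.swap) (simp add: sum_distrib_left mult_ac)
  then show ?thesis
    by (simp add: hmat_def matrix_matrix_mult_def transpose_def vec_eq_iff)
qed

text \<open>
  In the notation of the statement, \<open>cometric\<close> is $(h^{ij})$, \<open>Amat\<close> is $(A^{i\alpha})$, \<open>Bmat\<close> is
  $(B^{\alpha\beta})$ and \<open>nproj\<close> is $(\delta^\alpha_\beta - B^\alpha_\beta)$.  For the covector p with components
  $\tilde W_\alpha$, \<open>tpart\<close> is $A^{i\alpha}\tilde W_\alpha$ and \<open>npart\<close> is
  $\tilde W_\tau(\delta^\tau_\gamma - B^\tau_\gamma)$.
\<close>

definition cometric :: "real^'m^'m \<Rightarrow> real^'n^'m \<Rightarrow> real^'n^'n" where
  "cometric G z = matrix_inv (hmat G z)"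

definition Amat :: "real^'m^'m \<Rightarrow> real^'n^'m \<Rightarrow> real^'m^'n" where
  "Amat G z = cometric G z ** transpose z"

definition coef :: "real^'m^'m \<Rightarrow> real^'n^'m \<Rightarrow> real^'m^'n" where
  "coef G z = Amat G z ** G"

definition Bmat :: "real^'m^'m \<Rightarrow> real^'n^'m \<Rightarrow> real^'m^'m" where
  "Bmat G z = z ** Amat G z"

definition nproj :: "real^'m^'m \<Rightarrow> real^'n^'m \<Rightarrow> real^'m^'m" where
  "nproj G z = mat 1 - z ** coef G z"

definition tpart :: "real^'m^'m \<Rightarrow> real^'n^'m \<Rightarrow> real^'m \<Rightarrow> real^'n" where
  "tpart G z p = Amat G z *v p"

definition npart :: "real^'m^'m \<Rightarrow> real^'n^'m \<Rightarrow> real^'m \<Rightarrow> real^'m" where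
  "npart G z p = transpose (nproj G z) *v p"

lemma transpose_matrix_inv:
  fixes M :: "real^'n^'n"
  assumes "invertible M" "transpose M = M"
  shows "transpose (matrix_inv M) = matrix_inv M"
proof -
  have "M ** transpose (matrix_inv M) = mat 1"
    using matrix_inv_left[OF assms(1)] assms(2)
    by (metis matrix_transpose_mul transpose_mat)
  then show ?thesis
    by (metis assms(1) matrix_inv_left matrix_mul_assoc matrix_mul_lid matrix_mul_rid)
qed

lemma transpose_hmat: "transpose G = G \<Longrightarrow> transpose (hmat G z) = hmat G z"
  by (simp add: hmat_eq matrix_transpose_mul matrix_mul_assoc)

lemmas matrix_normalize = matrix_distribs matrix_mul_assoc[symmetric] 
  matrix_vector_mul_assoc[symmetric]

locale nondegenerate =
  fixes G :: "real^'m^'m" and z :: "real^'n^'m"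
  assumes sym: "transpose G = G" and inv: "invertible (hmat G z)"
begin

lemma transpose_cometric: "transpose (cometric G z) = cometric G z"
  unfolding cometric_def by (intro transpose_matrix_inv transpose_hmat inv sym)

text \<open>\<open>coef\<close> reads off the parameter coordinates of the tangential part of an
  ambient vector. This identity makes \<open>z ** coef G z\<close> a projection onto the image of z,
  so \<open>nproj\<close> annihilates tangent vectors.\<close>

lemma coef_z: "coef G z ** z = mat 1"
  using matrix_inv_left[OF inv]
  by (simp add: coef_def Amat_def cometric_def hmat_eq matrix_mul_assoc)

lemma coef_z_assoc: "coef G z ** (z ** M) = M"
  by (simp add: coef_z matrix_mul_assoc)

lemma coef_z_vec: "coef G z *v (z *v x) = x"
  by (simp add: coef_z matrix_vector_mul_assoc)

lemma transpose_Amat: "transpose (Amat G z) = z ** cometric G z"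
  by (simp add: Amat_def matrix_transpose_mul transpose_cometric)

lemma transpose_coef: "transpose (coef G z) = G ** (z ** cometric G z)"
  by (simp add: coef_def matrix_transpose_mul transpose_Amat sym)

lemma transpose_nproj: "transpose (nproj G z) = mat 1 - G ** Bmat G z"
  by (simp add: nproj_def matrix_distribs transpose_coef Bmat_def Amat_def matrix_mul_assoc)

lemma nproj_z: "nproj G z ** z = 0"
  by (simp add: nproj_def matrix_distribs matrix_mul_assoc[symmetric] coef_z)

lemma nproj_z_vec: "nproj G z *v (z *v x) = 0"
  by (simp add: nproj_z matrix_vector_mul_assoc matrix_distribs)

lemma transpose_z_npart: "transpose z *v npart G z p = 0"
  using arg_cong[OF nproj_z, of transpose]
  by (simp add: npart_def matrix_vector_mul_assoc matrix_distribs)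

lemma npart_z: "npart G z p \<bullet> (z *v x) = 0"
  using transpose_z_npart[of p] by (metis inner_commute inner_matrix_left inner_zero_right)

lemma npart_eq: "npart G z p = p - G *v (z *v tpart G z p)"
  by (simp add: npart_def transpose_nproj matrix_normalize tpart_def Bmat_def)

text \<open>Self-adjointness of the normal projection with respect to G: the tangential-normal
  splitting is orthogonal.\<close>

lemma G_nproj: "G ** nproj G z = transpose (nproj G z) ** G"
  unfolding transpose_nproj by (simp add: nproj_def matrix_normalize Bmat_def coef_def)

end

text \<open>
  If (G, z, p, w) moves with velocity (S, Z, q, \<omega>), then the functions \<open>var_\<dots>\<close> are the resulting velocities of
  \<open>coef\<close>, \<open>tpart\<close>, \<open>npart\<close>, of $\mathfrak s$, and of the logarithm of $\sqrt{\det h}$.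
  \<open>first_var\<close> and \<open>second_var\<close> are derivatives of the integrand divided by $\sqrt{\det h}/\chi$, where
  r0, r1, r2, L stand for $\varrho, \varrho', \varrho'', (\log\chi)'$.
\<close>

definition var_coef where
  "var_coef G z S Z = cometric G z ** (transpose Z ** (transpose (nproj G z) ** G))
     + Amat G z ** (S ** nproj G z) - coef G z ** (Z ** coef G z)"

definition var_tpart where
  "var_tpart G z p S q Z = cometric G z *v (transpose Z *v npart G z p)
     + Amat G z *v (q - S *v (z *v tpart G z p)) - coef G z *v (Z *v tpart G z p)"

definition var_npart where
  "var_npart G z p S q Z = transpose (nproj G z) *v (q - S *v (z *v tpart G z p))
     - transpose (coef G z) *v (transpose Z *v npart G z p)
     - G *v (nproj G z *v (Z *v tpart G z p))"

definition var_s :: "real^'m^'m \<Rightarrow> real^'n^'m \<Rightarrow> real^'m \<Rightarrow> real^'m^'m \<Rightarrow> real^'m \<Rightarrow> real \<Rightarrow> real^'n^'m \<Rightarrow> real" where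
  "var_s G z p S q \<omega> Z = - \<omega> + 2 * (q \<bullet> (z *v tpart G z p))
     - (z *v tpart G z p) \<bullet> (S *v (z *v tpart G z p)) + 2 * (npart G z p \<bullet> (Z *v tpart G z p))"

definition var_vol :: "real^'m^'m \<Rightarrow> real^'n^'m \<Rightarrow> real^'m^'m \<Rightarrow> real^'n^'m \<Rightarrow> real" where
  "var_vol G z S Z = trace (coef G z ** Z) + trace (Amat G z ** (S ** z)) / 2"

definition first_var where
  "first_var r0 r1 G z p Y = 2 * r1 * (npart G z p \<bullet> (Y *v tpart G z p)) + r0 * trace (coef G z ** Y)"

definition second_var where
  "second_var r0 r1 r2 L G z p S q \<omega> Z Y =
     (var_vol G z S Z - L * \<omega>) * first_var r0 r1 G z p Y
     + var_s G z p S q \<omega> Z * first_var r1 r2 G z p Y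
     + 2 * r1 * (var_npart G z p S q Z \<bullet> (Y *v tpart G z p) + npart G z p \<bullet> (Y *v var_tpart G z p S q Z))
     + r0 * trace (var_coef G z S Z ** Y)"

subsection \<open>Derivatives along a curve\<close>

text \<open>The curves \<open>p\<close> and \<open>w\<close> are not tied to a vector field. The
  same formulas therefore serve the integrand along lines in the variables (y, z) and, with
  \<open>p\<close> and \<open>w\<close> zero, the induced metric along the immersion.\<close>

locale variation =
  fixes G :: "real \<Rightarrow> real^'m^'m" and z :: "real \<Rightarrow> real^'n^'m" and p :: "real \<Rightarrow> real^'m"
    and w :: "real \<Rightarrow> real" and S q \<omega> Z t
  assumes dG: "(G has_vector_derivative S) (at t)" and dz: "(z has_vector_derivative Z) (at t)"
    and dp: "(p has_vector_derivative q) (at t)" and dw: "(w has_real_derivative \<omega>) (at t)"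
    and nd: "nondegenerate (G t) (z t)" and symS: "transpose S = S"
begin

sublocale nondegenerate "G t" "z t" by (rule nd)

lemma hmat_has_vector_derivative:
  "((\<lambda>t. hmat (G t) (z t)) has_vector_derivative
     transpose Z ** (G t ** z t) + transpose (z t) ** (S ** z t) + transpose (z t) ** (G t ** Z)) (at t)"
  unfolding hmat_eq
  by (rule has_vector_derivative_eq_rhs[OF matrix_mult_has_vector_derivative[OF
        matrix_mult_has_vector_derivative[OF transpose_has_vector_derivative[OF dz] dG] dz]])
    (simp add: matrix_normalize)

lemma cometric_has_vector_derivative:
  "((\<lambda>t. cometric (G t) (z t)) has_vector_derivative - (cometric (G t) (z t) **
     (transpose Z ** (G t ** z t) + transpose (z t) ** (S ** z t) + transpose (z t) ** (G t ** Z)) 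
      ** cometric (G t) (z t))) (at t)"
  unfolding cometric_def by (rule matrix_inv_has_vector_derivative[OF hmat_has_vector_derivative inv])

lemmas Amat_has_vector_derivative = matrix_mult_has_vector_derivative[OF cometric_has_vector_derivative
    transpose_has_vector_derivative[OF dz]]

text \<open>In the product rule the contribution of h^{-1} pairs with the derivatives of z^T and G:
  the terms in h^{-1} Z^T combine into 1 - G B, those in A S into 1 - z a with a =
  \<open>coef\<close>. This is how the normal projection enters all the variations.\<close>

lemma coef_has_vector_derivative:
  "((\<lambda>t. coef (G t) (z t)) has_vector_derivative var_coef (G t) (z t) S Z) (at t)"
  unfolding coef_def Amat_def
  by (rule has_vector_derivative_eq_rhs[OF matrix_mult_has_vector_derivative[OF Amat_has_vector_derivative dG]])
    (simp add: var_coef_def transpose_nproj Bmat_def nproj_def Amat_def coef_def transpose_cometric sym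
      matrix_normalize algebra_simps)

lemma tpart_has_vector_derivative:
  "((\<lambda>t. tpart (G t) (z t) (p t)) has_vector_derivative var_tpart (G t) (z t) (p t) S q Z) (at t)"
  unfolding tpart_def Amat_def
  by (rule has_vector_derivative_eq_rhs[OF matrix_vector_mult_has_vector_derivative[OF Amat_has_vector_derivative dp]])
    (simp add: var_tpart_def npart_def tpart_def transpose_nproj Bmat_def nproj_def Amat_def
      coef_def transpose_cometric sym matrix_normalize algebra_simps)

lemma npart_has_vector_derivative:
  "((\<lambda>t. npart (G t) (z t) (p t)) has_vector_derivative var_npart (G t) (z t) (p t) S q Z) (at t)"
  unfolding npart_def nproj_def
  by (rule has_vector_derivative_eq_rhs[OF matrix_vector_mult_has_vector_derivative[OF 
     transpose_has_vector_derivative[OF has_vector_derivative_diff[OF has_vector_derivative_const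
      matrix_mult_has_vector_derivative[OF dz coef_has_vector_derivative]]] dp]])
    (simp add: var_npart_def var_coef_def npart_def tpart_def transpose_nproj Bmat_def nproj_def Amat_def
      coef_def transpose_cometric sym symS matrix_normalize algebra_simps)

text \<open>The shape of \<open>var_s\<close> is an envelope formula: for positive definite h, p.(z
  u) is the maximum over v of 2 p.(z v) - v.(h v), attained at v = u, so the variation of u drops
  out. The computation itself uses the product rule; identities 1 to 3 absorb p, z and h^{-1} into u
  and \<open>npart\<close>.\<close>

lemma s_has_real_derivative:
  "((\<lambda>t. 1 - w t + p t \<bullet> (z t *v tpart (G t) (z t) (p t))) has_real_derivative
     var_s (G t) (z t) (p t) S q \<omega> Z) (at t)"
proof -
  let ?u = "tpart (G t) (z t) (p t)" and ?\<pi> = "npart (G t) (z t) (p t)"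
  have 1: "p t \<bullet> (z t *v (cometric (G t) (z t) *v x)) = ?u \<bullet> x" for x
    by (simp add: tpart_def Amat_def inner_matrix_left matrix_normalize transpose_cometric)
  have 2: "p t \<bullet> (z t *v (Amat (G t) (z t) *v x)) = (z t *v ?u) \<bullet> x" for x
    using 1 by (simp add: Amat_def matrix_normalize inner_matrix_left)
  have 3: "p t \<bullet> (z t *v (coef (G t) (z t) *v x)) = (p t - ?\<pi>) \<bullet> x" for x
    using 2 by (simp add: coef_def npart_eq matrix_normalize inner_matrix_left sym)
  have 4: "?u \<bullet> (transpose Z *v x) = x \<bullet> (Z *v ?u)" for x
    by (metis inner_commute inner_matrix_left)
  have "((\<lambda>t. p t \<bullet> (z t *v tpart (G t) (z t) (p t))) has_real_derivative
     var_s (G t) (z t) (p t) S q 0 Z) (at t)"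
    unfolding has_real_derivative_iff_has_vector_derivative
    by (rule has_vector_derivative_eq_rhs[OF inner_has_vector_derivative[OF dp
       matrix_vector_mult_has_vector_derivative[OF dz tpart_has_vector_derivative]]])
      (simp add: var_s_def var_tpart_def matrix_vector_right_distribs inner_add_right inner_diff_right
        inner_diff_left 1 2 3 4 inner_commute[of "z t *v ?u"])
  from DERIV_add[OF DERIV_diff[OF DERIV_const dw, of 1] this] show ?thesis
    by (simp add: var_s_def algebra_simps)
qed

text \<open>By Jacobi's formula half of the trace of h^{-1} h' appears. The two terms of h'
  containing Z are transposes of each other and have equal traces against the symmetric h^{-1}, so
  together they lose the factor 1/2.\<close>

lemma sqrt_det_has_real_derivative:
  assumes "det (hmat (G t) (z t)) > 0"
  shows "((\<lambda>t. sqrt (det (hmat (G t) (z t)))) has_real_derivative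
     sqrt (det (hmat (G t) (z t))) * var_vol (G t) (z t) S Z) (at t)"
proof -
  have "trace (cometric (G t) (z t) ** (transpose Z ** (G t ** z t))) =
      trace (transpose (cometric (G t) (z t) ** (transpose Z ** (G t ** z t))))"
    by (simp only: trace_transpose)
  also have "\<dots> = trace ((transpose (z t) ** (G t ** Z)) ** cometric (G t) (z t))"
    by (simp add: matrix_normalize transpose_cometric sym)
  also have "\<dots> = trace (coef (G t) (z t) ** Z)"
    by (subst trace_mul_sym) (simp add: coef_def Amat_def matrix_mul_assoc)
  finally have "trace (cometric (G t) (z t) ** (transpose Z ** (G t ** z t) +
      transpose (z t) ** (S ** z t) + transpose (z t) ** (G t ** Z))) = 2 * var_vol (G t) (z t) S Z"
    by (simp add: var_vol_def matrix_distribs) (simp add: coef_def Amat_def matrix_mul_assoc)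
  then have "((\<lambda>t. det (hmat (G t) (z t))) has_real_derivative
      det (hmat (G t) (z t)) * (2 * var_vol (G t) (z t) S Z)) (at t)"
    using det_has_derivative[OF hmat_has_vector_derivative inv] by (simp add: cometric_def)
  from DERIV_chain2[OF DERIV_real_sqrt[OF assms] this]
  have "((\<lambda>t. sqrt (det (hmat (G t) (z t)))) has_real_derivative
     inverse (sqrt (det (hmat (G t) (z t)))) / 2 * (det (hmat (G t) (z t)) * (2 * var_vol (G t) (z t) S Z))) (at t)" .
  moreover have "inverse (sqrt (det (hmat (G t) (z t)))) / 2 * (det (hmat (G t) (z t)) * (2 * v)) =
      sqrt (det (hmat (G t) (z t))) * v" for v
    using assms real_sqrt_mult_self[of "det (hmat (G t) (z t))"] by (simp add: field_simps)
  ultimately show ?thesis by (simp only:)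
qed

lemma first_var_has_real_derivative:
  assumes s: "s = 1 - w t + p t \<bullet> (z t *v tpart (G t) (z t) (p t))"
    and r0: "(r0 has_real_derivative r1 s) (at s)" and r1: "(r1 has_real_derivative r2) (at s)"
    and det: "det (hmat (G t) (z t)) > 0"
    and c: "(c has_real_derivative c (w t) * L) (at (w t))" "c (w t) > 0"
  defines "\<sigma> \<equiv> \<lambda>t. 1 - w t + p t \<bullet> (z t *v tpart (G t) (z t) (p t))"
  shows "((\<lambda>t. r0 (\<sigma> t) / c (w t) * sqrt (det (hmat (G t) (z t)))) has_real_derivative
      sqrt (det (hmat (G t) (z t))) / c (w t) * ((var_vol (G t) (z t) S Z - L * \<omega>) * r0 s
        + r1 s * var_s (G t) (z t) (p t) S q \<omega> Z)) (at t)" (is ?first)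
    and "((\<lambda>t. sqrt (det (hmat (G t) (z t))) / c (w t) * first_var (r0 (\<sigma> t)) (r1 (\<sigma> t)) (G t) (z t) (p t) Y)
      has_real_derivative sqrt (det (hmat (G t) (z t))) / c (w t) *
        second_var (r0 s) (r1 s) r2 L (G t) (z t) (p t) S q \<omega> Z Y) (at t)" (is ?second)
proof -
  note \<sigma>' = s_has_real_derivative[folded \<sigma>_def]
  have st: "\<sigma> t = s" by (simp add: \<sigma>_def s)
  have r0': "((\<lambda>t. r0 (\<sigma> t)) has_real_derivative r1 s * var_s (G t) (z t) (p t) S q \<omega> Z) (at t)"
    by (rule DERIV_chain2[OF _ \<sigma>']) (simp add: st r0)
  have r1': "((\<lambda>t. r1 (\<sigma> t)) has_real_derivative r2 * var_s (G t) (z t) (p t) S q \<omega> Z) (at t)"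
    by (rule DERIV_chain2[OF _ \<sigma>']) (simp add: st r1)
  have c': "((\<lambda>t. c (w t)) has_real_derivative c (w t) * L * \<omega>) (at t)"
    by (rule DERIV_chain2[OF c(1) dw])
  have vol': "((\<lambda>t. sqrt (det (hmat (G t) (z t))) / c (w t)) has_real_derivative
      sqrt (det (hmat (G t) (z t))) / c (w t) * (var_vol (G t) (z t) S Z - L * \<omega>)) (at t)"
    by (rule DERIV_cong[OF DERIV_divide[OF sqrt_det_has_real_derivative[OF det] c']])
      (use c(2) in \<open>auto simp: field_simps\<close>)
  from DERIV_mult[OF r0' vol'] show ?first
    by (simp add: st algebra_simps add_divide_distrib diff_divide_distrib)
  have n': "((\<lambda>t. npart (G t) (z t) (p t) \<bullet> (Y *v tpart (G t) (z t) (p t))) has_real_derivative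
     npart (G t) (z t) (p t) \<bullet> (Y *v var_tpart (G t) (z t) (p t) S q Z)
     + var_npart (G t) (z t) (p t) S q Z \<bullet> (Y *v tpart (G t) (z t) (p t))) (at t)"
    unfolding has_real_derivative_iff_has_vector_derivative
    by (rule has_vector_derivative_eq_rhs[OF inner_has_vector_derivative[OF npart_has_vector_derivative
       matrix_vector_mult_has_vector_derivative[OF has_vector_derivative_const tpart_has_vector_derivative]]])
      (simp add: matrix_vector_left_distribs)
  have t': "((\<lambda>t. trace (coef (G t) (z t) ** Y)) has_real_derivative trace (var_coef (G t) (z t) S Z ** Y)) (at t)"
    unfolding has_real_derivative_iff_has_vector_derivative
    by (rule has_vector_derivative_eq_rhs[OF trace_has_vector_derivative[OF 
       matrix_mult_has_vector_derivative[OF coef_has_vector_derivative has_vector_derivative_const]]])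
      (simp add: matrix_right_distribs)
  show ?second
    unfolding first_var_def
    by (rule DERIV_cong[OF DERIV_mult[OF vol' DERIV_add[OF DERIV_mult[OF DERIV_cmult[OF r1', of 2] n'] DERIV_mult[OF r0' t']]]])
     (simp add: second_var_def first_var_def st algebra_simps add_divide_distrib diff_divide_distrib)
qed

end

subsection \<open>Invariance of the second variation\<close>

text \<open>Joint linearity in the four velocities, stated on tuples, is what allows a velocity to
  be decomposed and its pieces to be treated separately.\<close>

lemma linear_second_var:
  fixes G :: "real^'m^'m" and z :: "real^'n^'m"
  shows "linear (\<lambda>(S, q, \<omega>, Z). second_var r0 r1 r2 L G z p S q \<omega> Z Y)"
proof -
  have 1: "linear (\<lambda>x. var_coef G z (fst x) (snd (snd (snd x))))" (is "linear ?a")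
    unfolding var_coef_def linear_iff
    by (auto simp: matrix_distribs transpose_scalar scaleR_right_distrib scaleR_right_diff_distrib
      bounded_bilinear.scaleR_left[OF bounded_bilinear_matrix_mult]
      bounded_bilinear.scaleR_right[OF bounded_bilinear_matrix_mult])
  have 2: "linear (\<lambda>x. var_tpart G z p (fst x) (fst (snd x)) (snd (snd (snd x))))" (is "linear ?t")
    unfolding var_tpart_def linear_iff
    by (auto simp: matrix_distribs transpose_scalar scaleR_right_distrib scaleR_right_diff_distrib
      bounded_bilinear.scaleR_left[OF bounded_bilinear_matrix_vector_mult]
      bounded_bilinear.scaleR_right[OF bounded_bilinear_matrix_vector_mult])
  have 3: "linear (\<lambda>x. var_npart G z p (fst x) (fst (snd x)) (snd (snd (snd x))))" (is "linear ?n")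
    unfolding var_npart_def linear_iff
    by (auto simp: matrix_distribs transpose_scalar scaleR_right_distrib scaleR_right_diff_distrib
      bounded_bilinear.scaleR_left[OF bounded_bilinear_matrix_vector_mult]
      bounded_bilinear.scaleR_right[OF bounded_bilinear_matrix_vector_mult])
  have 4: "linear (\<lambda>x. var_s G z p (fst x) (fst (snd x)) (fst (snd (snd x))) (snd (snd (snd x))))" (is "linear ?s")
    unfolding var_s_def linear_iff
    by (auto simp: matrix_distribs inner_simps algebra_simps
      bounded_bilinear.scaleR_left[OF bounded_bilinear_matrix_vector_mult])
  have 5: "linear (\<lambda>x. var_vol G z (fst x) (snd (snd (snd x))))" (is "linear ?v")
    unfolding var_vol_def linear_iff
    by (auto simp: matrix_distribs algebra_simps add_divide_distrib
      bounded_bilinear.scaleR_left[OF bounded_bilinear_matrix_mult]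
      bounded_bilinear.scaleR_right[OF bounded_bilinear_matrix_mult]
      linear_scale[OF bounded_linear.linear[OF bounded_linear_trace]])
  \<comment> \<open>Additivity and homogeneity on explicit 4-tuples, so that the five linear
    ingredients can be rewritten after the arguments have been split into components.\<close>
  note lin = linear_add[OF 1, of "(a, b, c, d)" "(a', b', c', d')" for a b c d a' b' c' d', simplified]
    linear_add[OF 2, of "(a, b, c, d)" "(a', b', c', d')" for a b c d a' b' c' d', simplified]
    linear_add[OF 3, of "(a, b, c, d)" "(a', b', c', d')" for a b c d a' b' c' d', simplified]
    linear_add[OF 4, of "(a, b, c, d)" "(a', b', c', d')" for a b c d a' b' c' d', simplified]
    linear_add[OF 5, of "(a, b, c, d)" "(a', b', c', d')" for a b c d a' b' c' d', simplified]
    linear_scale[OF 1, of _ "(a, b, c, d)" for a b c d, simplified]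
    linear_scale[OF 2, of _ "(a, b, c, d)" for a b c d, simplified]
    linear_scale[OF 3, of _ "(a, b, c, d)" for a b c d, simplified]
    linear_scale[OF 4, of _ "(a, b, c, d)" for a b c d, simplified]
    linear_scale[OF 5, of _ "(a, b, c, d)" for a b c d, simplified]
  have "linear (\<lambda>x. (?v x - L * fst (snd (snd x))) * first_var r0 r1 G z p Y
     + ?s x * first_var r1 r2 G z p Y
     + 2 * r1 * (?n x \<bullet> (Y *v tpart G z p) + npart G z p \<bullet> (Y *v ?t x))
     + r0 * trace (?a x ** Y))"
    unfolding linear_iff
    by (auto simp: lin matrix_distribs inner_simps algebra_simps
      bounded_bilinear.scaleR_left[OF bounded_bilinear_matrix_mult]
      bounded_bilinear.scaleR_right[OF bounded_bilinear_matrix_vector_mult]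
      linear_scale[OF bounded_linear.linear[OF bounded_linear_trace]])
  then show ?thesis
    by (simp add: second_var_def split_def)
qed

lemma linear_first_var: "linear (first_var r0 r1 G z p)"
  unfolding first_var_def linear_iff
    by (auto simp: matrix_distribs algebra_simps inner_simps
      bounded_bilinear.scaleR_right[OF bounded_bilinear_matrix_mult]
      bounded_bilinear.scaleR_left[OF bounded_bilinear_matrix_vector_mult]
      linear_scale[OF bounded_linear.linear[OF bounded_linear_trace]])

context nondegenerate
begin

lemma cometric_assoc: "cometric G z ** (transpose z ** M) = Amat G z ** M"
  by (simp add: Amat_def matrix_mul_assoc)

lemma Amat_G_assoc: "Amat G z ** (G ** M) = coef G z ** M"
  by (simp add: coef_def matrix_mul_assoc)

lemma cometric_vec: "cometric G z *v (transpose z *v x) = Amat G z *v x"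
  by (simp add: Amat_def matrix_vector_mul_assoc)

lemma Amat_G_vec: "Amat G z *v (G *v x) = coef G z *v x"
  by (simp add: coef_def matrix_vector_mul_assoc)

lemma nproj_mult: "N ** nproj G z = N - N ** (z ** coef G z)"
  by (simp add: nproj_def matrix_distribs)

lemma inner_coef_transpose: "(transpose (coef G z) *v (transpose Z *v x)) \<bullet> y = x \<bullet> (Z *v (coef G z *v y))"
  by (simp add: inner_matrix_left)

text \<open>
  The direction $(GM + M^T G, M^T p, -Mz)$ is tangent to the GL(m)-orbit of (G, p, z).
\<close>

lemma var_coef_equivariant:
  "var_coef G z (G ** M + transpose M ** G) (- (M ** z)) = coef G z ** M"
proof -
  have "coef G z ** (M ** nproj G z) = coef G z ** M - coef G z ** (M ** (z ** coef G z))"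
    by (simp add: nproj_mult matrix_distribs)
  then show ?thesis
    by (simp add: var_coef_def matrix_normalize G_nproj cometric_assoc Amat_G_assoc)
qed

text \<open>u = h^{-1} z^T p has only a parameter index, and both h and z^T p are invariant under
  the group.\<close>

lemma var_tpart_equivariant:
  "var_tpart G z p (G ** M + transpose M ** G) (transpose M *v p) (- (M ** z)) = 0"
  by (simp add: var_tpart_def matrix_normalize cometric_vec Amat_G_vec npart_eq)

text \<open>\<open>npart\<close> is an ambient covector, so it moves in the same way as p.\<close>

lemma var_npart_equivariant:
  "var_npart G z p (G ** M + transpose M ** G) (transpose M *v p) (- (M ** z)) = transpose M *v npart G z p"
proof -
  let ?x = "M *v (z *v tpart G z p)"
  have 1: "transpose (nproj G z) *v (G *v ?x) = G *v (nproj G z *v ?x)"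
    using G_nproj by (metis matrix_vector_mul_assoc)
  have 2: "transpose (nproj G z) *v y + transpose (coef G z) *v (transpose z *v y) = y" for y
    by (simp add: nproj_def matrix_normalize)
  have 3: "transpose M *v p - (G *v ?x + transpose M *v (G *v (z *v tpart G z p)))
     = transpose M *v npart G z p - G *v ?x"
    by (simp add: npart_eq matrix_normalize)
  have "var_npart G z p (G ** M + transpose M ** G) (transpose M *v p) (- (M ** z)) =
     transpose (nproj G z) *v (transpose M *v npart G z p) 
     + transpose (coef G z) *v (transpose z *v (transpose M *v npart G z p))"
    by (simp add: var_npart_def matrix_normalize flip: 3) (simp add: 1[symmetric] npart_eq matrix_normalize)
  then show ?thesis by (simp add: 2)
qed

lemma var_s_equivariant:
  "var_s G z p (G ** M + transpose M ** G) (transpose M *v p) 0 (- (M ** z)) = 0"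
proof -
  let ?y = "z *v tpart G z p"
  have "(transpose M *v p) \<bullet> ?y = p \<bullet> (M *v ?y)"
    by (simp add: inner_matrix_left)
  moreover have "?y \<bullet> (transpose M *v (G *v ?y)) = (G *v ?y) \<bullet> (M *v ?y)"
    by (simp add: inner_matrix_left[symmetric] inner_commute)
  moreover have "?y \<bullet> (G *v (M *v ?y)) = (G *v ?y) \<bullet> (M *v ?y)"
    by (simp add: inner_matrix_left sym)
  ultimately show ?thesis
    by (simp add: var_s_def matrix_normalize npart_eq inner_simps)
qed

lemma var_vol_equivariant: "var_vol G z (G ** M + transpose M ** G) (- (M ** z)) = 0"
proof -
  have "trace (Amat G z ** (transpose M ** (G ** z))) = trace (transpose (Amat G z ** (transpose M ** (G ** z))))"
    by (simp only: trace_transpose)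
  also have "\<dots> = trace ((transpose z ** (G ** (M ** z))) ** cometric G z)"
    by (simp add: matrix_normalize transpose_Amat sym)
  also have "\<dots> = trace (coef G z ** (M ** z))"
    by (subst trace_mul_sym) (simp add: coef_def Amat_def matrix_mul_assoc)
  finally show ?thesis
    by (simp add: var_vol_def matrix_normalize Amat_G_assoc)
qed

text \<open>By invariance the fibre derivative would be unchanged if \<open>Y\<close> moved along
  with z, with velocity -M Y. As \<open>Y\<close> is held fixed, the compensating first variation in
  direction M Y is left over.\<close>

lemma second_var_equivariant:
  "second_var r0 r1 r2 L G z p (G ** M + transpose M ** G) (transpose M *v p) 0 (- (M ** z)) Y
    = first_var r0 r1 G z p (M ** Y)"
  by (simp add: second_var_def var_vol_equivariant var_s_equivariant var_tpart_equivariant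
      var_npart_equivariant var_coef_equivariant first_var_def matrix_mul_assoc inner_matrix_left
      matrix_vector_mul_assoc)

text \<open>Equality of mixed second fibre derivatives, read off the explicit formula: its terms are
  symmetric because G P and h^{-1} are symmetric and traces are invariant under cyclic shifts and
  transposition.\<close>

lemma second_var_commute:
  "second_var r0 r1 r2 L G z p 0 0 0 Z Y = second_var r0 r1 r2 L G z p 0 0 0 Y Z"
proof -
  let ?u = "tpart G z p" and ?\<pi> = "npart G z p"
  have 1: "(G *v (nproj G z *v (Z *v ?u))) \<bullet> (Y *v ?u) = (G *v (nproj G z *v (Y *v ?u))) \<bullet> (Z *v ?u)"
  proof -
    have "(G *v (nproj G z *v x)) \<bullet> y = x \<bullet> ((G ** nproj G z) *v y)" for x y
      unfolding G_nproj by (simp add: inner_matrix_left sym matrix_normalize)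
    then show ?thesis by (metis inner_commute matrix_vector_mul_assoc)
  qed
  have 2: "?\<pi> \<bullet> (Y *v (cometric G z *v (transpose Z *v ?\<pi>))) = ?\<pi> \<bullet> (Z *v (cometric G z *v (transpose Y *v ?\<pi>)))"
  proof -
    have "?\<pi> \<bullet> (Y *v (cometric G z *v (transpose Z *v ?\<pi>))) =
      (Y *v (cometric G z *v (transpose Z *v ?\<pi>))) \<bullet> ?\<pi>" by (rule inner_commute)
    then show ?thesis by (simp add: inner_matrix_left transpose_cometric)
  qed
  have 3: "trace (coef G z ** (Z ** (coef G z ** Y))) = trace (coef G z ** (Y ** (coef G z ** Z)))"
    by (metis matrix_mul_assoc trace_mul_sym)
  have 4: "trace (cometric G z ** (transpose Z ** (transpose (nproj G z) ** (G ** Y)))) =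
    trace (cometric G z ** (transpose Y ** (transpose (nproj G z) ** (G ** Z))))"
  proof -
    have "trace (cometric G z ** (transpose Z ** (transpose (nproj G z) ** (G ** Y)))) =
      trace (transpose (cometric G z ** (transpose Z ** (transpose (nproj G z) ** (G ** Y)))))"
      by (simp only: trace_transpose)
    also have "\<dots> = trace ((transpose Y ** (G ** (nproj G z ** Z))) ** cometric G z)"
      by (simp add: matrix_normalize transpose_cometric sym)
    also have "\<dots> = trace (cometric G z ** (transpose Y ** ((G ** nproj G z) ** Z)))"
      by (subst trace_mul_sym) (simp add: matrix_mul_assoc)
    finally show ?thesis by (simp only: G_nproj matrix_mul_assoc)
  qed
  show ?thesis
    by (simp add: second_var_def var_vol_def var_s_def var_npart_def var_tpart_def var_coef_def
        matrix_normalize inner_simps inner_coef_transpose 1 2 3 4 first_var_def algebra_simps)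
qed

text \<open>The integrand is a density: replacing z by z A with det A > 0 multiplies it by det A.
  Differentiating its fibre derivative at z (1 + t K) in direction Y (1 + t K) gives trace K times
  the first variation, and the moving direction accounts for the subtracted term in Y K.\<close>

lemma second_var_tangential:
  "second_var r0 r1 r2 L G z p 0 0 0 (z ** K) Y =
    trace K * first_var r0 r1 G z p Y - first_var r0 r1 G z p (Y ** K)"
proof -
  have z: "transpose z ** (transpose (nproj G z) ** G) = 0"
    using arg_cong[OF nproj_z, of transpose] by (simp add: matrix_mul_assoc matrix_distribs)
  have "trace (K ** (coef G z ** Y)) = trace (coef G z ** (Y ** K))"
    by (metis matrix_mul_assoc trace_mul_sym)
  then show ?thesis
    by (simp add: second_var_def var_vol_def var_s_def var_npart_def var_tpart_def var_coef_def
        matrix_normalize coef_z_assoc coef_z_vec transpose_z_npart npart_z nproj_z_vec z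
        inner_simps first_var_def algebra_simps)
qed

text \<open>The assumption says that the columns of N are G-orthogonal to the tangent space. Hence
  \<open>coef\<close> kills N, \<open>nproj\<close> fixes it, p and \<open>npart\<close> agree on
  it, and the volume does not change to first order.\<close>

lemma second_var_normal:
  assumes N: "transpose N ** (G ** z) = 0"
  shows "second_var r0 r1 r2 L G z p 0 0 0 N Y = 2 * (p \<bullet> (N *v tpart G z p)) * first_var r1 r2 G z p Y
    + 2 * r1 * (npart G z p \<bullet> (Y *v (cometric G z *v (transpose N *v p)))
       - p \<bullet> (N *v (coef G z *v (Y *v tpart G z p))) 
       - (G *v (N *v tpart G z p)) \<bullet> (Y *v tpart G z p))
    + r0 * trace (cometric G z ** (transpose N ** (G ** Y)))"
proof -
  have aN: "coef G z ** N = 0"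
    using arg_cong[OF N, of transpose] 
    by (simp add: matrix_distribs sym coef_def Amat_def matrix_mul_assoc[symmetric])
  then have PN: "nproj G z ** N = N"
    by (simp add: nproj_def matrix_normalize)
  then have NP: "transpose N ** transpose (nproj G z) = transpose N"
    by (metis matrix_transpose_mul)
  have PNv: "nproj G z *v (N *v x) = N *v x" for x
    by (simp add: PN matrix_vector_mul_assoc)
  have aNv: "coef G z *v (N *v x) = 0" for x
    by (simp add: aN matrix_vector_mul_assoc)
  have Np: "transpose N *v npart G z p = transpose N *v p"
    by (simp add: npart_def NP matrix_vector_mul_assoc)
  have pN: "npart G z p \<bullet> (N *v x) = p \<bullet> (N *v x)" for x
    using Np by (metis inner_commute inner_matrix_left)
  have NPG: "transpose N ** (transpose (nproj G z) ** M) = transpose N ** M" for M :: "real^'m^'m"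
    by (simp add: matrix_mul_assoc NP)
  have aNa: "coef G z ** (N ** M) = 0" for M :: "real^'m^'n"
    by (simp add: matrix_mul_assoc aN matrix_distribs)
  show ?thesis
    by (simp add: second_var_def var_vol_def var_s_def var_npart_def var_tpart_def var_coef_def
        matrix_normalize aN aNv aNa Np NPG PNv pN inner_coef_transpose inner_simps first_var_def algebra_simps)
qed

end

section \<open>Evaluation on matrix units, the coordinate directions of the fibre variables
  z^c_i\<close>

lemma matrix_unit_vec: "axis c (axis i 1) *v x = x $ i *\<^sub>R axis c 1" for x :: "real^'n"
proof (subst vec_eq_iff, intro allI)
  fix a show "(axis c (axis i 1) *v x) $ a = (x $ i *\<^sub>R axis c 1) $ a"
    by (cases "a = c") (simp_all add: matrix_vector_mul_component inner_axis', simp_all add: axis_def)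
qed

lemma sum_column_mult: "(\<Sum>i\<in>UNIV. x $ i *\<^sub>R column i N) = N *v x" for N :: "real^'k^'l"
  by (simp add: vec_eq_iff matrix_vector_mult_def column_def mult.commute)

lemma matrix_vector_axis: "(M *v axis c 1) $ i = M $ i $ c" for M :: "real^'m^'n"
  by (simp add: matrix_vector_mult_basis column_def)

lemma trace_matrix_unit: "trace (M ** axis c (axis i 1)) = M $ i $ c" for M :: "real^'m^'n"
proof -
  have "(axis c (axis i 1) ** M) $ a $ a = (axis c (axis i 1) *v column a M) $ a" for a
    by (simp add: matrix_matrix_mult_def matrix_vector_mult_def column_def)
  also have "\<dots> a = (if a = c then M $ i $ c else 0)" for a
    unfolding matrix_unit_vec by (simp add: column_def axis_def)
  finally show ?thesis by (subst trace_mul_sym) (simp add: trace_def)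
qed

lemma first_var_matrix_unit:
  "first_var r0 r1 G z p (axis c (axis i 1)) = 2 * r1 * (npart G z p $ c * tpart G z p $ i) + r0 * coef G z $ i $ c"
  by (simp add: first_var_def matrix_unit_vec trace_matrix_unit inner_axis)

text \<open>Only the covector and the squared norm move: this is the effect of differentiating the
  vector field after the metric's own variation has been split off.\<close>

lemma second_var_matrix_unit:
  fixes G :: "real^'m^'m" and z :: "real^'n^'m"
  shows
  "second_var r0 r1 r2 L G z p 0 r \<omega> 0 (axis c (axis i 1)) =
    - L * \<omega> * (2 * r1 * (npart G z p $ c * tpart G z p $ i) + r0 * coef G z $ i $ c)
    + (2 * (r \<bullet> (z *v tpart G z p)) - \<omega>) * (2 * r2 * (npart G z p $ c * tpart G z p $ i) + r1 * coef G z $ i $ c)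
    + 2 * r1 * ((transpose (nproj G z) *v r) $ c * tpart G z p $ i + npart G z p $ c * (Amat G z *v r) $ i)"
proof -
  let ?E = "axis c (axis i 1) :: real^'n^'m"
  have "var_npart G z p 0 r 0 = transpose (nproj G z) *v r" "var_tpart G z p 0 r 0 = Amat G z *v r"
    "var_coef G z 0 0 = 0" "var_vol G z 0 0 = 0" "var_s G z p 0 r \<omega> 0 = 2 * (r \<bullet> (z *v tpart G z p)) - \<omega>"
    by (simp_all add: var_npart_def var_tpart_def var_coef_def var_vol_def var_s_def matrix_distribs)
  then have "second_var r0 r1 r2 L G z p 0 r \<omega> 0 ?E = (0 - L * \<omega>) * first_var r0 r1 G z p ?E
     + (2 * (r \<bullet> (z *v tpart G z p)) - \<omega>) * first_var r1 r2 G z p ?E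
     + 2 * r1 * ((transpose (nproj G z) *v r) \<bullet> (?E *v tpart G z p) + npart G z p \<bullet> (?E *v (Amat G z *v r)))"
    by (simp add: second_var_def matrix_distribs)
  then show ?thesis
    by (simp add: first_var_matrix_unit matrix_unit_vec inner_axis mult.commute)
qed

section \<open>Contraction of the field-derivative part and of the normal part\<close>

context nondegenerate
begin

text \<open>\<open>R\<close> stands for the lowered covariant derivative of the field and \<omega>
  for the gradient of its squared norm. The unprojected components at \<open>c\<close> of \<omega>
  and of R z u cancel between the base derivative and the contracted mixed derivatives, leaving only
  normal projections. Two equal contributions in R z u produce the coefficient 4.\<close>

lemma skew_part:
  fixes p :: "real^'m"
  assumes R: "transpose R = - R"
  defines "u \<equiv> tpart G z p" and "\<pi> \<equiv> npart G z p"
  shows "- L * \<omega> $ c * r0 + r1 * (2 * ((R *v axis c 1) \<bullet> (z *v u)) - \<omega> $ c)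
     - (\<Sum>i\<in>UNIV. second_var r0 r1 r2 L G z p 0 (R *v column i z) (\<omega> \<bullet> column i z) 0 (axis c (axis i 1)))
    = L * (2 * r1 * \<pi> $ c * (\<omega> \<bullet> (z *v u)) - r0 * (transpose (nproj G z) *v \<omega>) $ c)
      + (2 * r2 * \<pi> $ c * (\<omega> \<bullet> (z *v u)) - r1 * (transpose (nproj G z) *v \<omega>) $ c)
      - 4 * r1 * (transpose (nproj G z) *v (R *v (z *v u))) $ c"
proof -
  let ?P = "nproj G z" and ?a = "coef G z"
  have skew: "x \<bullet> (R *v y) = - ((R *v x) \<bullet> y)" for x y
  proof -
    have "(R *v x) \<bullet> y = x \<bullet> (transpose R *v y)" by (rule inner_matrix_left)
    then show ?thesis by (simp add: R matrix_distribs)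
  qed
  have 1: "(\<Sum>i\<in>UNIV. (x \<bullet> column i z) * y $ i) = x \<bullet> (z *v y)" for x y
    by (simp add: sum_column_mult[of y z, symmetric] inner_sum_right mult.commute)
  have Pc: "?P *v axis c 1 = axis c 1 - z *v (?a *v axis c 1)"
    by (simp add: nproj_def matrix_normalize)
  \<comment> \<open>Contracting with the columns of z and with \<open>coef\<close> extracts the
    tangential part of the covector x, that is x minus its normal part.\<close>
  have 2: "(\<Sum>i\<in>UNIV. (x \<bullet> column i z) * ?a $ i $ c) = x $ c - (transpose ?P *v x) $ c" for x
  proof -
    have "(\<Sum>i\<in>UNIV. (x \<bullet> column i z) * ?a $ i $ c) = x \<bullet> (z *v (?a *v axis c 1))"
      using 1[of x "?a *v axis c 1"] by (simp only: matrix_vector_axis)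
    also have "\<dots> = x \<bullet> (axis c 1 - ?P *v axis c 1)" by (simp add: Pc)
    also have "\<dots> = x $ c - (transpose ?P *v x) $ c"
      by (simp add: inner_diff_right inner_axis inner_commute[of x] inner_matrix_left inner_axis')
    finally show ?thesis .
  qed
  have 3: "(\<Sum>i\<in>UNIV. ((R *v column i z) \<bullet> y) * u $ i) = - ((R *v y) \<bullet> (z *v u))" for y
    using 1[of "- (R *v y)" u] by (simp add: skew inner_commute[of _ y] inner_minus_left)
  have 4: "(\<Sum>i\<in>UNIV. ((R *v column i z) \<bullet> y) * ?a $ i $ c) = - (R *v y) $ c + (transpose ?P *v (R *v y)) $ c" for y
    using 2[of "- (R *v y)"] by (simp add: skew inner_commute[of _ y] inner_minus_left matrix_distribs)
  have 5: "(\<Sum>i\<in>UNIV. (transpose ?P *v (R *v column i z)) $ c * u $ i) = (transpose ?P *v (R *v (z *v u))) $ c"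
  proof -
    have "transpose ?P *v (R *v (z *v u)) = (\<Sum>i\<in>UNIV. u $ i *\<^sub>R (transpose ?P *v (R *v column i z)))"
      by (simp add: sum_column_mult[of u z, symmetric] linear_sum[OF matrix_vector_mul_linear] matrix_vector_mult_scaleR)
    then show ?thesis by (simp add: mult.commute)
  qed
  \<comment> \<open>This is the trace of the symmetric h^{-1} against the skew matrix z^T R z, hence
    equal to its own negative.\<close>
  have 6: "(\<Sum>i\<in>UNIV. (Amat G z *v (R *v column i z)) $ i) = 0"
  proof -
    have "(\<Sum>i\<in>UNIV. (Amat G z *v (R *v column i z)) $ i) = trace (Amat G z ** (R ** z))"
      by (simp only: trace_def matrix_vector_mult_basis[symmetric] matrix_vector_axis
          matrix_vector_mul_assoc matrix_mul_assoc)
    moreover have "trace (Amat G z ** (R ** z)) = trace (transpose (Amat G z ** (R ** z)))"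
      by (simp only: trace_transpose)
    moreover have "trace (transpose (Amat G z ** (R ** z))) = - trace ((transpose z ** (R ** z)) ** cometric G z)"
      by (simp add: matrix_normalize transpose_Amat R)
    moreover have "trace ((transpose z ** (R ** z)) ** cometric G z) = trace (Amat G z ** (R ** z))"
      by (subst trace_mul_sym) (simp add: Amat_def matrix_mul_assoc)
    ultimately show ?thesis by linarith
  qed
  have 7: "(R *v (z *v u)) \<bullet> (z *v u) = 0"
    using skew[of "z *v u" "z *v u"] by (simp add: inner_commute)
  have 8: "(R *v axis c 1) \<bullet> (z *v u) = - (R *v (z *v u)) $ c"
    by (simp add: inner_commute[of "R *v axis c 1"] skew inner_axis)
  have "(\<Sum>i\<in>UNIV. second_var r0 r1 r2 L G z p 0 (R *v column i z) (\<omega> \<bullet> column i z) 0 (axis c (axis i 1)))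
    = (\<Sum>i\<in>UNIV. - L * (2 * r1 * \<pi> $ c * ((\<omega> \<bullet> column i z) * u $ i) + r0 * ((\<omega> \<bullet> column i z) * ?a $ i $ c))
       + 2 * (2 * r2 * \<pi> $ c * (((R *v column i z) \<bullet> (z *v u)) * u $ i) + r1 * (((R *v column i z) \<bullet> (z *v u)) * ?a $ i $ c))
       - (2 * r2 * \<pi> $ c * ((\<omega> \<bullet> column i z) * u $ i) + r1 * ((\<omega> \<bullet> column i z) * ?a $ i $ c))
       + 2 * r1 * ((transpose (nproj G z) *v (R *v column i z)) $ c * u $ i + \<pi> $ c * (Amat G z *v (R *v column i z)) $ i))"
    unfolding second_var_matrix_unit u_def[symmetric] \<pi>_def[symmetric]
    by (intro sum.cong refl) algebra
  also have "\<dots> = - L * (2 * r1 * \<pi> $ c * (\<omega> \<bullet> (z *v u)) + r0 * (\<omega> $ c - (transpose ?P *v \<omega>) $ c))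
     + 2 * (2 * r2 * \<pi> $ c * - ((R *v (z *v u)) \<bullet> (z *v u)) + r1 * (- (R *v (z *v u)) $ c + (transpose ?P *v (R *v (z *v u))) $ c))
     - (2 * r2 * \<pi> $ c * (\<omega> \<bullet> (z *v u)) + r1 * (\<omega> $ c - (transpose ?P *v \<omega>) $ c))
     + 2 * r1 * ((transpose ?P *v (R *v (z *v u))) $ c + \<pi> $ c * 0)"
    unfolding sum.distrib sum_subtractf sum_distrib_left[symmetric] 1 2 3 4 5 6 by (rule refl)
  also note 7
  finally show ?thesis unfolding 8 by algebra
qed

text \<open>\<open>N i\<close> plays the second fundamental form with one lower index fixed. Its
  symmetry in the two lower indices removes every term containing \<open>coef\<close>, which has no
  counterpart in the target formula.\<close>

lemma normal_part:
  fixes N :: "'n \<Rightarrow> real^'n^'m" and p :: "real^'m"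
  assumes N: "\<And>i. transpose (N i) ** (G ** z) = 0" and symN: "\<And>i j a. N i $ a $ j = N j $ a $ i"
  defines "u \<equiv> tpart G z p" and "\<pi> \<equiv> npart G z p"
  shows "(\<Sum>i\<in>UNIV. second_var r0 r1 r2 L G z p 0 0 0 (N i) (axis c (axis i 1)))
    = (\<Sum>i\<in>UNIV. \<Sum>j\<in>UNIV. \<Sum>a\<in>UNIV. (cometric G z $ i $ j * (2 * r1 * p $ a * \<pi> $ c + r0 * G $ c $ a)
        + 2 * (u $ i * u $ j) * (2 * r2 * p $ a * \<pi> $ c - r1 * G $ c $ a)) * N i $ a $ j)"
proof -
  let ?a = "coef G z" and ?C = "cometric G z"
  have G: "G $ a $ b = G $ b $ a" for a b
    by (rule symmetric_entries[OF sym])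
  define n where "n i j = (\<Sum>a\<in>UNIV. p $ a * N i $ a $ j)" for i j
  define m where "m i j = (\<Sum>a\<in>UNIV. G $ c $ a * N i $ a $ j)" for i j
  have n: "n i j = n j i" for i j unfolding n_def using symN by simp
  have pN: "p \<bullet> (N i *v x) = (\<Sum>j\<in>UNIV. n i j * x $ j)" for i x
    unfolding n_def inner_vec_def matrix_vector_mult_def
    by (simp add: sum_distrib_left sum_distrib_right mult_ac) (rule sum.swap)
  have CN: "(?C *v (transpose (N i) *v p)) $ i = (\<Sum>j\<in>UNIV. ?C $ i $ j * n i j)" for i
    unfolding n_def by (simp add: matrix_vector_mult_def transpose_def mult.commute)
  have GN: "(G *v (N i *v u)) $ c = (\<Sum>j\<in>UNIV. m i j * u $ j)" for i
    unfolding m_def by (simp add: matrix_vector_mult_def sum_distrib_left sum_distrib_right mult_ac) (rule sum.swap)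
  have tr: "(?C ** (transpose (N i) ** G)) $ i $ c = (\<Sum>j\<in>UNIV. ?C $ i $ j * m i j)" for i
    unfolding m_def by (simp add: matrix_matrix_mult_def transpose_def G[of c] mult.commute)
  have "second_var r0 r1 r2 L G z p 0 0 0 (N i) (axis c (axis i 1)) =
     2 * (p \<bullet> (N i *v u)) * (2 * r2 * (\<pi> $ c * u $ i) + r1 * ?a $ i $ c)
     + 2 * r1 * (\<pi> $ c * (?C *v (transpose (N i) *v p)) $ i - u $ i * (p \<bullet> (N i *v column c ?a)) - (G *v (N i *v u)) $ c * u $ i)
     + r0 * (?C ** (transpose (N i) ** G)) $ i $ c" for i
    unfolding second_var_normal[OF N] first_var_matrix_unit
    using trace_matrix_unit[of "?C ** (transpose (N i) ** G)" c i]
    by (simp add: matrix_unit_vec inner_axis u_def \<pi>_def matrix_vector_right_distribs matrix_vector_mult_scaleR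
       matrix_vector_mult_basis matrix_mul_assoc)
  also have "\<dots> i = (\<Sum>j\<in>UNIV. 4 * r2 * \<pi> $ c * (u $ i * u $ j * n i j) + 2 * r1 * (n i j * u $ j * ?a $ i $ c)
      + 2 * r1 * \<pi> $ c * (?C $ i $ j * n i j) - 2 * r1 * (n i j * ?a $ j $ c * u $ i) - 2 * r1 * (u $ i * u $ j * m i j)
      + r0 * (?C $ i $ j * m i j))" for i
    unfolding pN CN GN tr
    by (simp add: sum.distrib sum_subtractf sum_distrib_left sum_distrib_right column_def algebra_simps)
  finally have sv: "second_var r0 r1 r2 L G z p 0 0 0 (N i) (axis c (axis i 1)) = 
      (\<Sum>j\<in>UNIV. 4 * r2 * \<pi> $ c * (u $ i * u $ j * n i j) + 2 * r1 * (n i j * u $ j * ?a $ i $ c)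
      + 2 * r1 * \<pi> $ c * (?C $ i $ j * n i j) - 2 * r1 * (n i j * ?a $ j $ c * u $ i) - 2 * r1 * (u $ i * u $ j * m i j)
      + r0 * (?C $ i $ j * m i j))" for i .
  have "(\<Sum>i\<in>UNIV. second_var r0 r1 r2 L G z p 0 0 0 (N i) (axis c (axis i 1))) = (\<Sum>i\<in>UNIV. \<Sum>j\<in>UNIV. 
      4 * r2 * \<pi> $ c * (u $ i * u $ j * n i j) 
      + 2 * r1 * \<pi> $ c * (?C $ i $ j * n i j) - 2 * r1 * (u $ i * u $ j * m i j)
      + r0 * (?C $ i $ j * m i j)) + 2 * r1 * ((\<Sum>i\<in>UNIV. \<Sum>j\<in>UNIV. n i j * u $ j * ?a $ i $ c)
       - (\<Sum>i\<in>UNIV. \<Sum>j\<in>UNIV. n i j * ?a $ j $ c * u $ i))"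
    unfolding sv by (simp add: sum.distrib sum_subtractf sum_distrib_left algebra_simps)
  \<comment> \<open>The two double sums with \<open>coef\<close> differ by exchanging i and j, and n
    is symmetric.\<close>
  also have "(\<Sum>i\<in>UNIV. \<Sum>j\<in>UNIV. n i j * u $ j * ?a $ i $ c) = (\<Sum>i\<in>UNIV. \<Sum>j\<in>UNIV. n i j * ?a $ j $ c * u $ i)"
    by (subst sum.swap) (intro sum.cong refl, subst n, simp)
  moreover have "(\<Sum>a\<in>UNIV. (?C $ i $ j * (2 * r1 * p $ a * \<pi> $ c + r0 * G $ c $ a)
        + 2 * (u $ i * u $ j) * (2 * r2 * p $ a * \<pi> $ c - r1 * G $ c $ a)) * N i $ a $ j)
    = 4 * r2 * \<pi> $ c * (u $ i * u $ j * n i j) + 2 * r1 * \<pi> $ c * (?C $ i $ j * n i j)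
      - 2 * r1 * (u $ i * u $ j * m i j) + r0 * (?C $ i $ j * m i j)" for i j
    unfolding n_def m_def sum_distrib_left sum.distrib[symmetric] sum_subtractf[symmetric]
    by (intro sum.cong refl) algebra
  ultimately show ?thesis by (simp only: diff_self mult_zero_right add_0_right)
qed

end

subsection \<open>Symmetry of second derivatives\<close>

text \<open>Young's argument: the mean value theorem in direction v, applied to the difference of
  \<phi> on two parallel segments, turns the second difference into t times a difference of values
  of \<open>pd \<phi> v\<close>, to which differentiability at the single point x applies. The limit
  is one-sided because the segments have length parameter t > 0.\<close>

lemma second_difference_tendsto:
  fixes \<phi> :: "'a::real_normed_vector \<Rightarrow> real"
  assumes S: "open S" "x \<in> S" and \<phi>: "\<And>y. y \<in> S \<Longrightarrow> \<phi> differentiable (at y)"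
    and D: "(pd \<phi> v has_derivative D) (at x)"
  shows "((\<lambda>t. (\<phi> (x + t *\<^sub>R v + t *\<^sub>R w) - \<phi> (x + t *\<^sub>R v) - \<phi> (x + t *\<^sub>R w) + \<phi> x) / t\<^sup>2) \<longlongrightarrow> D w) (at_right 0)"
proof (rule tendstoI)
  fix e :: real assume e: "e > 0"
  let ?A = "pd \<phi> v"
  \<comment> \<open>The points reached lie within distance t k of x. Two remainder estimates of size
    e' t k add up to (2/3) e t, strictly below e t.\<close>
  define k where "k = norm v + norm w + 1"
  define e' where "e' = e / (3 * k)"
  have k: "k > 0" "norm v \<le> k" "norm w \<le> k" "norm v + norm w \<le> k" by (auto simp: k_def add_nonneg_pos)
  have e': "e' > 0" using e k by (simp add: e'_def)
  obtain d1 where d1: "d1 > 0" "ball x d1 \<subseteq> S" using S open_contains_ball by blast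
  obtain d2 where d2: "d2 > 0" "\<And>y. norm (y - x) < d2 \<Longrightarrow> norm (?A y - ?A x - D (y - x)) \<le> e' * norm (y - x)"
    using D e' unfolding has_derivative_at_alt by blast
  have lin: "linear D" using D has_derivative_linear by blast
  define d where "d = min d1 d2 / k"
  have d: "d > 0" using d1 d2 k by (simp add: d_def)
  have dphi: "((\<lambda>s. \<phi> (y + s *\<^sub>R v)) has_real_derivative ?A (y + s *\<^sub>R v)) (at s)" if yS: "y + s *\<^sub>R v \<in> S" for y s
  proof -
    obtain P where P: "(\<phi> has_derivative P) (at (y + s *\<^sub>R v))"
      using \<phi>[OF yS] by (auto simp: differentiable_def)
    interpret P: bounded_linear P using P by (rule has_derivative_bounded_linear)
    have "((\<lambda>r. \<phi> (y + r *\<^sub>R v)) has_derivative (\<lambda>r. P (r *\<^sub>R v))) (at s)"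
      by (rule has_derivative_compose[of "\<lambda>r. y + r *\<^sub>R v" _ s UNIV \<phi> P, simplified])
        (use P in \<open>auto intro!: derivative_eq_intros\<close>)
    then have 1: "((\<lambda>r. \<phi> (y + r *\<^sub>R v)) has_real_derivative P v) (at s)"
      by (simp add: has_field_derivative_def P.scaleR mult.commute[of _ "P v"])
    have "((\<lambda>r. \<phi> ((y + s *\<^sub>R v) + r *\<^sub>R v)) has_real_derivative P v) (at 0)"
      using DERIV_shift[of "\<lambda>r. \<phi> (y + r *\<^sub>R v)" "P v" 0 s] 1 by (simp add: algebra_simps)
    then have "?A (y + s *\<^sub>R v) = P v"
      unfolding pd_def by (rule DERIV_imp_deriv)
    with 1 show ?thesis by simp
  qed
  have "dist ((\<phi> (x + t *\<^sub>R v + t *\<^sub>R w) - \<phi> (x + t *\<^sub>R v) - \<phi> (x + t *\<^sub>R w) + \<phi> x) / t\<^sup>2) (D w) < e"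
    if t: "0 < t" "t < d" for t
  proof -
    have tk: "t * k < min d1 d2" using t k by (simp add: d_def pos_less_divide_eq)
    have bnd: "norm (s *\<^sub>R v + r *\<^sub>R w) \<le> t * k" if "0 \<le> s" "s \<le> t" "0 \<le> r" "r \<le> t" for s r
    proof -
      have "norm (s *\<^sub>R v + r *\<^sub>R w) \<le> s * norm v + r * norm w"
        using norm_triangle_ineq[of "s *\<^sub>R v" "r *\<^sub>R w"] that by simp
      also have "\<dots> \<le> t * norm v + t * norm w"
        using that by (intro add_mono mult_right_mono) auto
      also have "\<dots> \<le> t * k" using k(4) t by (simp add: distrib_left[symmetric])
      finally show ?thesis .
    qed
    have inS: "x + s *\<^sub>R v + r *\<^sub>R w \<in> S" if "0 \<le> s" "s \<le> t" "0 \<le> r" "r \<le> t" for s r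
    proof -
      have "norm (s *\<^sub>R v + r *\<^sub>R w) < d1" using bnd[OF that] tk by linarith
      then have "x + (s *\<^sub>R v + r *\<^sub>R w) \<in> ball x d1"
        by (simp only: mem_ball dist_norm add_diff_cancel_left' norm_minus_commute[of x])
      then have "x + s *\<^sub>R v + r *\<^sub>R w \<in> ball x d1"
        by (simp only: add.assoc)
      with d1 show ?thesis by blast
    qed
    have "\<exists>\<xi>. 0 < \<xi> \<and> \<xi> < t \<and> (\<phi> (x + t *\<^sub>R w + t *\<^sub>R v) - \<phi> (x + t *\<^sub>R v)) - (\<phi> (x + t *\<^sub>R w + 0 *\<^sub>R v) - \<phi> (x + 0 *\<^sub>R v))
        = (t - 0) * (?A (x + t *\<^sub>R w + \<xi> *\<^sub>R v) - ?A (x + \<xi> *\<^sub>R v))"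
    proof (rule MVT2[OF t(1)])
      fix s assume "0 \<le> s" "s \<le> t"
      then show "((\<lambda>s. \<phi> (x + t *\<^sub>R w + s *\<^sub>R v) - \<phi> (x + s *\<^sub>R v)) has_real_derivative
          ?A (x + t *\<^sub>R w + s *\<^sub>R v) - ?A (x + s *\<^sub>R v)) (at s)"
        using inS[of s t] inS[of s 0] t by (intro DERIV_diff dphi) (auto simp: add_ac)
    qed
    then obtain \<xi> where \<xi>: "0 < \<xi>" "\<xi> < t" and eq: "(\<phi> (x + t *\<^sub>R w + t *\<^sub>R v) - \<phi> (x + t *\<^sub>R v))
        - (\<phi> (x + t *\<^sub>R w + 0 *\<^sub>R v) - \<phi> (x + 0 *\<^sub>R v))
        = (t - 0) * (?A (x + t *\<^sub>R w + \<xi> *\<^sub>R v) - ?A (x + \<xi> *\<^sub>R v))"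
      by blast
    have "t *\<^sub>R w + s *\<^sub>R v = s *\<^sub>R v + t *\<^sub>R w" for s
      by (rule add.commute)
    with eq have \<xi>3: "\<phi> (x + t *\<^sub>R v + t *\<^sub>R w) - \<phi> (x + t *\<^sub>R v) - \<phi> (x + t *\<^sub>R w) + \<phi> x
        = t * (?A (x + (\<xi> *\<^sub>R v + t *\<^sub>R w)) - ?A (x + (\<xi> *\<^sub>R v + 0 *\<^sub>R w)))"
      by (simp add: add.assoc diff_diff_eq2)
    have est: "\<bar>?A (x + h) - ?A x - D h\<bar> \<le> e' * (t * k)" if "norm h \<le> t * k" for h
    proof -
      have "\<bar>?A (x + h) - ?A x - D h\<bar> \<le> e' * norm h" using d2(2)[of "x + h"] that tk by simp
      also have "\<dots> \<le> e' * (t * k)" using that e' by (intro mult_left_mono) auto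
      finally show ?thesis .
    qed
    have "D (\<xi> *\<^sub>R v + t *\<^sub>R w) - D (\<xi> *\<^sub>R v + 0 *\<^sub>R w) = t * D w"
      by (simp add: linear_add[OF lin] linear_scale[OF lin])
    then have "\<bar>(?A (x + (\<xi> *\<^sub>R v + t *\<^sub>R w)) - ?A (x + (\<xi> *\<^sub>R v + 0 *\<^sub>R w))) - t * D w\<bar> \<le> 2 * (e' * (t * k))"
      using est[OF bnd[of \<xi> t]] est[OF bnd[of \<xi> 0]] \<xi> t by simp
    also have "\<dots> = t * (2 / 3 * e)" using k by (simp add: e'_def)
    also have "\<dots> < t * e" using t e by simp
    finally have lt: "\<bar>(?A (x + (\<xi> *\<^sub>R v + t *\<^sub>R w)) - ?A (x + (\<xi> *\<^sub>R v + 0 *\<^sub>R w))) - t * D w\<bar> < t * e" .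
    have X: "t * X / t\<^sup>2 - D w = (X - t * D w) / t" for X
      using t by (simp add: field_simps power2_eq_square)
    show ?thesis
      using lt t unfolding \<xi>3 dist_real_def X by (simp add: pos_divide_less_eq mult.commute[of e])
  qed
  then show "\<forall>\<^sub>F t in at_right 0. dist ((\<phi> (x + t *\<^sub>R v + t *\<^sub>R w) - \<phi> (x + t *\<^sub>R v) - \<phi> (x + t *\<^sub>R w) + \<phi> x) / t\<^sup>2) (D w) < e"
    using d by (auto simp: eventually_at_right_field)
qed

text \<open>Links the one-variable derivative behind \<open>pd\<close> to the Frechet derivative;
  the empty list of directions in \<open>smooth_on\<close> supplies differentiability of \<phi>
  itself.\<close>

lemma smooth_on_has_derivative:
  assumes "smooth_on S \<phi>" "a \<in> S"
  shows "(\<phi> has_derivative (\<lambda>v. pd \<phi> v a)) (at a)"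
proof -
  have "iter_pd \<phi> [] differentiable_on S" "open S" using assms unfolding smooth_on_def by blast+
  then have "\<phi> differentiable (at a)"
    using assms(2) by (simp add: differentiable_on_eq_differentiable_at)
  then obtain P where P: "(\<phi> has_derivative P) (at a)" by (auto simp: differentiable_def)
  interpret P: bounded_linear P using P by (rule has_derivative_bounded_linear)
  have "pd \<phi> v a = P v" for v
  proof -
    have "((\<lambda>r. \<phi> (a + r *\<^sub>R v)) has_derivative (\<lambda>r. P (r *\<^sub>R v))) (at 0)"
      by (rule has_derivative_compose[of "\<lambda>r. a + r *\<^sub>R v" _ 0 UNIV \<phi> P, simplified]) (use P in \<open>auto intro!: derivative_eq_intros\<close>)
    then have "((\<lambda>r. \<phi> (a + r *\<^sub>R v)) has_real_derivative P v) (at 0)"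
      by (simp add: has_field_derivative_def P.scaleR mult.commute[of _ "P v"])
    then show ?thesis unfolding pd_def by (rule DERIV_imp_deriv)
  qed
  with P show ?thesis by simp
qed

lemma iter_pd_append: "iter_pd g (vs @ ws) = iter_pd (iter_pd g ws) vs"
  by (induction vs) auto

lemma smooth_on_pd: "smooth_on S \<phi> \<Longrightarrow> smooth_on S (pd \<phi> v)"
proof -
  assume "smooth_on S \<phi>"
  moreover have "iter_pd (pd \<phi> v) vs = iter_pd \<phi> (vs @ [v])" for vs
    by (simp add: iter_pd_append)
  ultimately show ?thesis by (simp add: smooth_on_def)
qed

text \<open>The second difference is symmetric in v and w, so both iterated derivatives are its
  limit.\<close>

lemma pd_commute:
  assumes "smooth_on S \<phi>" "x \<in> S"
  shows "pd (pd \<phi> v) w x = pd (pd \<phi> w) v x"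
proof -
  have S: "open S" using assms by (simp add: smooth_on_def)
  have d: "\<phi> differentiable (at y)" if "y \<in> S" for y
    using smooth_on_has_derivative[OF assms(1) that] by (rule differentiableI)
  have 1: "((\<lambda>t. (\<phi> (x + t *\<^sub>R v + t *\<^sub>R w) - \<phi> (x + t *\<^sub>R v) - \<phi> (x + t *\<^sub>R w) + \<phi> x) / t\<^sup>2) \<longlongrightarrow> pd (pd \<phi> v) w x) (at_right 0)"
    by (rule second_difference_tendsto[OF S assms(2) d smooth_on_has_derivative[OF smooth_on_pd[OF assms(1)] assms(2)]])
  have 2: "((\<lambda>t. (\<phi> (x + t *\<^sub>R w + t *\<^sub>R v) - \<phi> (x + t *\<^sub>R w) - \<phi> (x + t *\<^sub>R v) + \<phi> x) / t\<^sup>2) \<longlongrightarrow> pd (pd \<phi> w) v x) (at_right 0)"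
    by (rule second_difference_tendsto[OF S assms(2) d smooth_on_has_derivative[OF smooth_on_pd[OF assms(1)] assms(2)]])
  have "(\<lambda>t. (\<phi> (x + t *\<^sub>R w + t *\<^sub>R v) - \<phi> (x + t *\<^sub>R w) - \<phi> (x + t *\<^sub>R v) + \<phi> x) / t\<^sup>2)
     = (\<lambda>t. (\<phi> (x + t *\<^sub>R v + t *\<^sub>R w) - \<phi> (x + t *\<^sub>R v) - \<phi> (x + t *\<^sub>R w) + \<phi> x) / t\<^sup>2)"
    by (simp add: algebra_simps)
  with 2 have "((\<lambda>t. (\<phi> (x + t *\<^sub>R v + t *\<^sub>R w) - \<phi> (x + t *\<^sub>R v) - \<phi> (x + t *\<^sub>R w) + \<phi> x) / t\<^sup>2) \<longlongrightarrow> pd (pd \<phi> w) v x) (at_right 0)"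
    by simp
  from tendsto_unique[OF _ 1 this] show ?thesis by simp
qed

subsection \<open>Volume data and positivity\<close>

lemma rho_derivatives:
  assumes "s > 0"
  shows "(rho vt n has_real_derivative deriv (rho vt n) s) (at s)"
    and "(deriv (rho vt n) has_real_derivative deriv (deriv (rho vt n)) s) (at s)"
    and "rho vt n s > 0"
proof -
  define k where "k = (case vt of BH \<Rightarrow> - (real n / 2) | HT \<Rightarrow> 1/2)"
  have rho: "rho vt n = (\<lambda>s. s powr k)"
    by (auto simp: rho_def k_def fun_eq_iff split: volform.split)
  show "rho vt n s > 0" using assms by (simp add: rho)
  have D: "((\<lambda>s. s powr k) has_real_derivative k * x powr (k - 1)) (at x)" if "x > 0" for x k :: real
    using has_real_derivative_powr[OF that] .
  have d: "deriv (rho vt n) x = k * x powr (k - 1)" if "x > 0" for x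
    using D[OF that, of k] by (simp add: rho DERIV_imp_deriv)
  show "(rho vt n has_real_derivative deriv (rho vt n) s) (at s)"
    using D[OF assms, of k] unfolding d[OF assms] by (simp add: rho)
  have D2: "((\<lambda>s. k * s powr (k - 1)) has_real_derivative k * ((k - 1) * s powr (k - 1 - 1))) (at s)"
    by (intro DERIV_cmult D assms)
  \<comment> \<open>The power formula for the first derivative holds for positive arguments, so it
    is differentiated again after passing to a neighbourhood of s.\<close>
  have ev: "eventually (\<lambda>x. k * x powr (k - 1) = deriv (rho vt n) x) (nhds s)"
    using eventually_nhds_in_open[OF open_greaterThan, of s 0] assms d by (auto elim!: eventually_mono)
  have "(deriv (rho vt n) has_real_derivative k * ((k - 1) * s powr (k - 1 - 1))) (at s)"
    using D2 unfolding DERIV_cong_ev[OF refl ev refl] .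
  then show "(deriv (rho vt n) has_real_derivative deriv (deriv (rho vt n)) s) (at s)"
    by (simp add: DERIV_imp_deriv)
qed

lemma chi_derivative:
  assumes "w < 1"
  shows "(chi vt n has_real_derivative chi vt n w * deriv (\<lambda>w. ln (chi vt n w)) w) (at w)"
    and "chi vt n w > 0"
proof -
  \<comment> \<open>Exponent 0 covers the BH case: (1 - v) powr 0 equals 1 because the base is
    nonzero for v < 1.\<close>
  define k where "k = (case vt of BH \<Rightarrow> 0 | HT \<Rightarrow> (real n + 1) / 2)"
  have chi: "chi vt n v = (1 - v) powr k" if "v < 1" for v
    using that by (auto simp: chi_def k_def split: volform.split)
  show pos: "chi vt n w > 0" using assms by (simp add: chi)
  have D1: "((\<lambda>v. (1 - v) powr k) has_real_derivative - k * (1 - w) powr (k - 1)) (at w)"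
    using assms by (auto intro!: derivative_eq_intros simp: powr_diff)
  have ev: "eventually (\<lambda>v. (1 - v) powr k = chi vt n v) (nhds w)"
    using eventually_nhds_in_open[OF open_lessThan, of w 1] assms chi by (auto elim!: eventually_mono)
  have D: "(chi vt n has_real_derivative - k * (1 - w) powr (k - 1)) (at w)"
    using D1 unfolding DERIV_cong_ev[OF refl ev refl] .
  have "deriv (\<lambda>w. ln (chi vt n w)) w = inverse (chi vt n w) * (- k * (1 - w) powr (k - 1))"
    using DERIV_chain2[OF DERIV_ln[OF pos] D] by (rule DERIV_imp_deriv)
  then have "chi vt n w * deriv (\<lambda>w. ln (chi vt n w)) w = - k * (1 - w) powr (k - 1)"
    using pos by (simp add: mult.assoc[symmetric])
  with D show "(chi vt n has_real_derivative chi vt n w * deriv (\<lambda>w. ln (chi vt n w)) w) (at w)"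
    by (simp only:)
qed

text \<open>Every matrix on the segment from the identity to H is positive definite, hence
  nonsingular. If det H were not positive, the intermediate value theorem would give a singular
  matrix on that segment.\<close>

lemma det_pos_of_positive_definite:
  fixes H :: "real^'n^'n"
  assumes "\<And>x. x \<noteq> 0 \<Longrightarrow> x \<bullet> (H *v x) > 0"
  shows "det H > 0"
proof (rule ccontr)
  assume neg: "\<not> det H > 0"
  define M where "M t = (1 - t) *\<^sub>R mat 1 + t *\<^sub>R H" for t :: real
  have comp: "M t $ i $ j = (1 - t) * (mat 1 :: real^'n^'n) $ i $ j + t * H $ i $ j" for t i j
    by (simp add: M_def)
  have "\<exists>t\<ge>0. t \<le> 1 \<and> det (M t) = 0"
  proof (rule IVT2')
    show "det (M 1) \<le> 0" "0 \<le> det (M 0)" using neg by (simp_all add: M_def)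
    show "continuous_on {0..1} (\<lambda>t. det (M t))"
      unfolding det_def comp by (intro continuous_intros)
  qed simp
  then obtain t where t: "0 \<le> t" "t \<le> 1" "det (M t) = 0" by blast
  then have "\<not> invertible (M t)" by (simp add: invertible_det_nz)
  then obtain x where x: "M t *v x = 0" "x \<noteq> 0"
    using matrix_left_invertible_ker[of "M t"] invertible_left_inverse[of "M t"] by blast
  have "x \<bullet> (M t *v x) = (1 - t) * (x \<bullet> x) + t * (x \<bullet> (H *v x))"
    by (simp add: M_def matrix_vector_left_distribs inner_add_right scaleR_matrix_vector_assoc[symmetric])
  moreover have "\<dots> > 0"
    using t assms[OF x(2)] x(2)
    by (cases "t = 0") (auto intro!: add_nonneg_pos)
  ultimately show False using x(1) by simp
qed

subsection \<open>The Euler-Lagrange expression\<close>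

lemma matrix_unit_expansion:
  "M = (\<Sum>j\<in>UNIV. \<Sum>e\<in>UNIV. M $ e $ j *\<^sub>R axis e (axis j 1))" for M :: "real^'n^'m"
proof -
  have "(\<Sum>j\<in>UNIV. \<Sum>e\<in>UNIV. M $ e $ j *\<^sub>R axis e (axis j 1)) $ a $ b = M $ a $ b" for a b
  proof -
    have "M $ e $ j * axis e (axis j 1) $ a $ b = (if e = a then if j = b then M $ a $ b else 0 else 0)" for e j
      by (simp add: axis_def)
    then show ?thesis by simp
  qed
  then show ?thesis by (simp add: vec_eq_iff)
qed

lemma sum_axis: "(\<Sum>e\<in>UNIV. v $ e *\<^sub>R axis e 1) = v" for v :: "real^'m"
  by (simp add: vec_eq_iff axis_def if_distrib[of "\<lambda>x. _ * x"] cong: if_cong)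

context nondegenerate
begin

text \<open>\<Gamma> and K play the Christoffel matrices of the ambient and the induced metric, and
  Z i the second derivatives of the immersion. The base derivative contributes the first variation
  in direction \<Gamma>_c z, and the contracted second variations contribute it again, so it
  cancels; the terms with K cancel among themselves.\<close>

lemma euler_lagrange_reduction:
  fixes \<Gamma> :: "'m \<Rightarrow> real^'m^'m" and K :: "'n \<Rightarrow> real^'n^'n" and p :: "real^'m"
    and \<tau> :: "'n \<Rightarrow> real^'n^'m" and \<omega> :: "real^'m" and r0 r1 r2 L :: real
  assumes \<Gamma>: "\<And>e b a. \<Gamma> e $ a $ b = \<Gamma> b $ a $ e" and K: "\<And>i j k. K i $ k $ j = K j $ k $ i"
    and S: "\<And>e. S e = G ** \<Gamma> e + transpose (\<Gamma> e) ** G"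
    and q: "\<And>e. q e = R *v axis e 1 + transpose (\<Gamma> e) *v p"
    and Z: "\<And>i. Z i = \<tau> i - (\<Sum>e\<in>UNIV. z $ e $ i *\<^sub>R \<Gamma> e) ** z + z ** K i"
  defines "SV \<equiv> second_var r0 r1 r2 L G z p"
  shows "((var_vol G z (S c) 0 - L * \<omega> $ c) * r0 + r1 * var_s G z p (S c) (q c) (\<omega> $ c) 0)
      - (\<Sum>i\<in>UNIV. \<Sum>j\<in>UNIV. \<Sum>e\<in>UNIV. SV 0 0 0 (axis c (axis i 1)) (axis e (axis j 1)) * Z i $ e $ j)
      - (\<Sum>i\<in>UNIV. \<Sum>e\<in>UNIV. SV (S e) (q e) (\<omega> $ e) 0 (axis c (axis i 1)) * z $ e $ i)
    = (- L * \<omega> $ c * r0 + r1 * (2 * ((R *v axis c 1) \<bullet> (z *v tpart G z p)) - \<omega> $ c)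
      - (\<Sum>i\<in>UNIV. SV 0 (R *v column i z) (\<omega> \<bullet> column i z) 0 (axis c (axis i 1))))
      - (\<Sum>i\<in>UNIV. SV 0 0 0 (\<tau> i) (axis c (axis i 1)))"
proof -
  define E where "E i = (axis c (axis i 1) :: real^'n^'m)" for i
  define M where "M i = (\<Sum>e\<in>UNIV. z $ e $ i *\<^sub>R \<Gamma> e)" for i
  define \<Lambda> where "\<Lambda> i = (\<lambda>(S, q, \<omega>, Z). SV S q \<omega> Z (E i))" for i
  let ?F = "first_var r0 r1 G z p"
  have lin: "linear (\<Lambda> i)" for i
    unfolding \<Lambda>_def SV_def by (rule linear_second_var)
  have col: "(\<Sum>e\<in>UNIV. z $ e $ i *\<^sub>R axis e 1) = column i z" for i
    using sum_axis[of "column i z"] by (simp add: column_def)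
  \<comment> \<open>\<open>second_var_commute\<close> moves the matrix unit of the inner derivative
    into the velocity slot, where linearity assembles \<open>Z i\<close>.\<close>
  have zz: "(\<Sum>j\<in>UNIV. \<Sum>e\<in>UNIV. SV 0 0 0 (E i) (axis e (axis j 1)) * Z i $ e $ j) = \<Lambda> i (0, 0, 0, Z i)" for i
  proof -
    have "SV 0 0 0 (E i) (axis e (axis j 1)) * Z i $ e $ j = \<Lambda> i (Z i $ e $ j *\<^sub>R (0, 0, 0, axis e (axis j 1)))" for e j
      unfolding linear_scale[OF lin] by (simp add: \<Lambda>_def SV_def second_var_commute)
    then have "(\<Sum>j\<in>UNIV. \<Sum>e\<in>UNIV. SV 0 0 0 (E i) (axis e (axis j 1)) * Z i $ e $ j) =
      \<Lambda> i (\<Sum>j\<in>UNIV. \<Sum>e\<in>UNIV. Z i $ e $ j *\<^sub>R (0, 0, 0, axis e (axis j 1)))"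
      by (simp only: linear_sum[OF lin])
    also have "(\<Sum>j\<in>UNIV. \<Sum>e\<in>UNIV. Z i $ e $ j *\<^sub>R (0 :: real^'m^'m, 0 :: real^'m, 0 :: real, axis e (axis j 1) :: real^'n^'m)) =
       (0, 0, 0, Z i)"
      by (simp add: scaleR_Pair sum_prod flip: matrix_unit_expansion)
    finally show ?thesis .
  qed
  have xz: "(\<Sum>e\<in>UNIV. SV (S e) (q e) (\<omega> $ e) 0 (E i) * z $ e $ i) =
     \<Lambda> i (G ** M i + transpose (M i) ** G, R *v column i z + transpose (M i) *v p, \<omega> \<bullet> column i z, 0)" for i
  proof -
    have "SV (S e) (q e) (\<omega> $ e) 0 (E i) * z $ e $ i = \<Lambda> i (z $ e $ i *\<^sub>R (S e, q e, \<omega> $ e, 0))" for e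
      unfolding linear_scale[OF lin] by (simp add: \<Lambda>_def)
    then have "(\<Sum>e\<in>UNIV. SV (S e) (q e) (\<omega> $ e) 0 (E i) * z $ e $ i) =
      \<Lambda> i (\<Sum>e\<in>UNIV. z $ e $ i *\<^sub>R (S e, q e, \<omega> $ e, 0))"
      by (simp only: linear_sum[OF lin])
    also have "(\<Sum>e\<in>UNIV. z $ e $ i *\<^sub>R (S e, q e, \<omega> $ e, 0 :: real^'n^'m)) =
       (\<Sum>e\<in>UNIV. z $ e $ i *\<^sub>R S e, \<Sum>e\<in>UNIV. z $ e $ i *\<^sub>R q e, \<Sum>e\<in>UNIV. z $ e $ i * \<omega> $ e, 0)"
      by (simp add: scaleR_Pair sum_prod)
    also have "(\<Sum>e\<in>UNIV. z $ e $ i *\<^sub>R S e) = G ** M i + transpose (M i) ** G"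
      by (simp add: S M_def scaleR_right_distrib sum.distrib
          bounded_bilinear.sum_right[OF bounded_bilinear_matrix_mult]
          bounded_bilinear.sum_left[OF bounded_bilinear_matrix_mult]
          bounded_bilinear.scaleR_right[OF bounded_bilinear_matrix_mult]
          bounded_bilinear.scaleR_left[OF bounded_bilinear_matrix_mult]
          linear_sum[OF bounded_linear.linear[OF bounded_linear_transpose]] transpose_scalar)
    also have "(\<Sum>e\<in>UNIV. z $ e $ i *\<^sub>R q e) = R *v column i z + transpose (M i) *v p"
      by (simp add: q M_def scaleR_right_distrib sum.distrib col[symmetric]
          bounded_bilinear.sum_right[OF bounded_bilinear_matrix_vector_mult]
          bounded_bilinear.sum_left[OF bounded_bilinear_matrix_vector_mult]
          bounded_bilinear.scaleR_right[OF bounded_bilinear_matrix_vector_mult]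
          bounded_bilinear.scaleR_left[OF bounded_bilinear_matrix_vector_mult]
          linear_sum[OF bounded_linear.linear[OF bounded_linear_transpose]] transpose_scalar)
    also have "(\<Sum>e\<in>UNIV. z $ e $ i * \<omega> $ e) = \<omega> \<bullet> column i z"
      by (simp add: inner_vec_def column_def mult.commute)
    finally show ?thesis .
  qed
  \<comment> \<open>The total velocity is regrouped as orbit direction, motion of the field, second
    fundamental form and reparametrisation.\<close>
  have split: "\<Lambda> i (0, 0, 0, Z i) + \<Lambda> i (G ** M i + transpose (M i) ** G, R *v column i z + transpose (M i) *v p, \<omega> \<bullet> column i z, 0)
    = ?F (M i ** E i) + SV 0 (R *v column i z) (\<omega> \<bullet> column i z) 0 (E i) + SV 0 0 0 (\<tau> i) (E i)
      + (trace (K i) * ?F (E i) - ?F (E i ** K i))" for i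
  proof -
    have "\<Lambda> i (0, 0, 0, Z i) + \<Lambda> i (G ** M i + transpose (M i) ** G, R *v column i z + transpose (M i) *v p, \<omega> \<bullet> column i z, 0)
      = \<Lambda> i ((G ** M i + transpose (M i) ** G, transpose (M i) *v p, 0, - (M i ** z)) 
          + (0, R *v column i z, \<omega> \<bullet> column i z, 0) + (0, 0, 0, \<tau> i) + (0, 0, 0, z ** K i))"
      by (simp add: linear_add[OF lin, symmetric] Z M_def[symmetric] algebra_simps)
    also have "\<dots> = SV (G ** M i + transpose (M i) ** G) (transpose (M i) *v p) 0 (- (M i ** z)) (E i)
      + SV 0 (R *v column i z) (\<omega> \<bullet> column i z) 0 (E i) + SV 0 0 0 (\<tau> i) (E i) + SV 0 0 0 (z ** K i) (E i)"
      unfolding linear_add[OF lin] by (simp add: \<Lambda>_def)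
    finally show ?thesis
      by (simp add: SV_def second_var_equivariant second_var_tangential)
  qed
  have x: "(var_vol G z (S c) 0 - L * \<omega> $ c) * r0 + r1 * var_s G z p (S c) (q c) (\<omega> $ c) 0
    = ?F (\<Gamma> c ** z) - L * \<omega> $ c * r0 + r1 * (2 * ((R *v axis c 1) \<bullet> (z *v tpart G z p)) - \<omega> $ c)"
  proof -
    have vol: "var_vol G z (S c) 0 = trace (coef G z ** (\<Gamma> c ** z))"
      using var_vol_equivariant[of "\<Gamma> c"] by (simp add: var_vol_def S matrix_distribs)
    have s: "var_s G z p (S c) (q c) (\<omega> $ c) 0 =
      2 * ((R *v axis c 1) \<bullet> (z *v tpart G z p)) - \<omega> $ c + 2 * (npart G z p \<bullet> ((\<Gamma> c ** z) *v tpart G z p))"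
      using var_s_equivariant[of p "\<Gamma> c"] by (simp add: var_s_def S q matrix_distribs inner_simps)
    show ?thesis unfolding vol s first_var_def by algebra
  qed
  \<comment> \<open>M_i E_i has the c-th column of M_i in position i and zeros elsewhere; by
    symmetry of \<Gamma> in its lower indices that column is the i-th column of \<Gamma>_c
    z.\<close>
  have 1: "(\<Sum>i\<in>UNIV. ?F (M i ** E i)) = ?F (\<Gamma> c ** z)"
  proof -
    have "(M i ** E i) $ a $ j = (if j = i then (\<Gamma> c ** z) $ a $ i else 0)" for i j a
    proof -
      have "M i $ a $ b * E i $ b $ j = (if b = c then (if j = i then M i $ a $ c else 0) else 0)" for b
        by (simp add: E_def axis_def)
      then have "(M i ** E i) $ a $ j = (if j = i then M i $ a $ c else 0)"
        by (simp add: matrix_matrix_mult_def)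
      also have "M i $ a $ c = (\<Gamma> c ** z) $ a $ i"
        by (simp add: M_def matrix_matrix_mult_def \<Gamma>[of c] mult.commute)
      finally show ?thesis .
    qed
    then have "(\<Sum>i\<in>UNIV. M i ** E i) = \<Gamma> c ** z"
      by (simp add: vec_eq_iff)
    then show ?thesis by (metis linear_sum[OF linear_first_var])
  qed
  \<comment> \<open>Both sums equal the first variation in the matrix whose row c has entries trace
    K_j: for E_i K_i this needs the symmetry of K in its lower indices.\<close>
  have 2: "(\<Sum>i\<in>UNIV. trace (K i) * ?F (E i)) = (\<Sum>i\<in>UNIV. ?F (E i ** K i))"
  proof -
    have EK: "(E i ** K i) $ a $ j = (if a = c then K i $ i $ j else 0)" for i j a
    proof -
      have "E i $ a $ b * K i $ b $ j = (if b = i then (if a = c then K i $ i $ j else 0) else 0)" for b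
        by (simp add: E_def axis_def)
      then show ?thesis by (simp add: matrix_matrix_mult_def)
    qed
    have "(\<Sum>i\<in>UNIV. trace (K i) *\<^sub>R E i) $ a $ j = (\<Sum>i\<in>UNIV. E i ** K i) $ a $ j" for a j
    proof -
      have "trace (K i) * E i $ a $ j = (if i = j then (if a = c then trace (K j) else 0) else 0)" for i
        by (auto simp: E_def axis_def)
      then show ?thesis
        by (simp add: EK trace_def) (simp add: K[of j])
    qed
    then have "(\<Sum>i\<in>UNIV. trace (K i) *\<^sub>R E i) = (\<Sum>i\<in>UNIV. E i ** K i)"
      by (simp add: vec_eq_iff)
    from arg_cong[OF this, of ?F] show ?thesis
      by (simp add: linear_sum[OF linear_first_var] linear_scale[OF linear_first_var])
  qed
  have "(\<Sum>i\<in>UNIV. \<Sum>j\<in>UNIV. \<Sum>e\<in>UNIV. SV 0 0 0 (E i) (axis e (axis j 1)) * Z i $ e $ j)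
      + (\<Sum>i\<in>UNIV. \<Sum>e\<in>UNIV. SV (S e) (q e) (\<omega> $ e) 0 (E i) * z $ e $ i)
    = ?F (\<Gamma> c ** z) + (\<Sum>i\<in>UNIV. SV 0 (R *v column i z) (\<omega> \<bullet> column i z) 0 (E i)) + (\<Sum>i\<in>UNIV. SV 0 0 0 (\<tau> i) (E i))"
    unfolding zz xz sum.distrib[symmetric] split
    unfolding sum.distrib sum_subtractf 1 2 by simp
  then show ?thesis
    unfolding x E_def[symmetric] by simp
qed

end

subsection \<open>Derivatives of the navigation data\<close>

definition dmat :: "('a::real_normed_vector \<Rightarrow> real^'k^'l) \<Rightarrow> 'a \<Rightarrow> 'a \<Rightarrow> real^'k^'l" where
  "dmat g y v = (\<chi> a b. pd (\<lambda>u. g u $ a $ b) v y)"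

definition dvec :: "('a::real_normed_vector \<Rightarrow> real^'k) \<Rightarrow> 'a \<Rightarrow> 'a \<Rightarrow> real^'k" where
  "dvec W y v = (\<chi> a. pd (\<lambda>u. W u $ a) v y)"

lemma smooth_on_curve:
  assumes "smooth_on S \<phi>" "(\<gamma> has_vector_derivative v) (at t)" "\<gamma> t \<in> S"
  shows "((\<lambda>s. \<phi> (\<gamma> s)) has_vector_derivative pd \<phi> v (\<gamma> t)) (at t)"
proof -
  note D = smooth_on_has_derivative[OF assms(1,3)]
  interpret P: bounded_linear "\<lambda>v. pd \<phi> v (\<gamma> t)" using D by (rule has_derivative_bounded_linear)
  show ?thesis
    using has_derivative_compose[OF assms(2)[unfolded has_vector_derivative_def] D]
    by (simp add: has_vector_derivative_def P.scaleR)
qed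

lemma dmat_curve:
  assumes "\<And>a b. smooth_on S (\<lambda>y. g y $ a $ b)" "(\<gamma> has_vector_derivative v) (at t)" "\<gamma> t \<in> S"
  shows "((\<lambda>s. g (\<gamma> s)) has_vector_derivative dmat g (\<gamma> t) v) (at t)"
  by (intro has_vector_derivative_componentwise) (simp add: dmat_def smooth_on_curve[OF assms])

lemma dvec_curve:
  assumes "\<And>a. smooth_on S (\<lambda>y. W y $ a)" "(\<gamma> has_vector_derivative v) (at t)" "\<gamma> t \<in> S"
  shows "((\<lambda>s. W (\<gamma> s)) has_vector_derivative dvec W (\<gamma> t) v) (at t)"
  by (intro has_vector_derivative_componentwise) (simp add: dvec_def smooth_on_curve[OF assms])

lemma has_vector_derivative_line: "((\<lambda>t. y + t *\<^sub>R v) has_vector_derivative v) (at t)"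
  by (auto intro!: derivative_eq_intros)

lemma dmat_eqI:
  assumes "((\<lambda>t. g (y + t *\<^sub>R v)) has_vector_derivative D) (at 0)"
  shows "dmat g y v = D"
proof -
  have "((\<lambda>t. g (y + t *\<^sub>R v) $ a $ b) has_real_derivative D $ a $ b) (at 0)" for a b
    using vec_nth_has_vector_derivative[OF vec_nth_has_vector_derivative[OF assms]]
    by (simp add: has_real_derivative_iff_has_vector_derivative)
  then show ?thesis
    by (simp add: dmat_def pd_def vec_eq_iff DERIV_imp_deriv)
qed

lemma dmat_linear:
  assumes "\<And>a b. smooth_on S (\<lambda>y. g y $ a $ b)" "y \<in> S"
  shows "linear (dmat g y)"
proof -
  have "linear (\<lambda>v. pd (\<lambda>u. g u $ a $ b) v y)" for a b
    using smooth_on_has_derivative[OF assms] by (rule has_derivative_linear)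
  then show ?thesis
    by (simp add: linear_iff dmat_def vec_eq_iff)
qed

definition low :: "(real^'m \<Rightarrow> real^'m^'m) \<Rightarrow> (real^'m \<Rightarrow> real^'m) \<Rightarrow> real^'m \<Rightarrow> real^'m" where
  "low g W y = g y *v W y"

definition dlow :: "(real^'m \<Rightarrow> real^'m^'m) \<Rightarrow> (real^'m \<Rightarrow> real^'m) \<Rightarrow> real^'m \<Rightarrow> real^'m \<Rightarrow> real^'m" where
  "dlow g W y v = g y *v dvec W y v + dmat g y v *v W y"

definition dnrm :: "(real^'m \<Rightarrow> real^'m^'m) \<Rightarrow> (real^'m \<Rightarrow> real^'m) \<Rightarrow> real^'m \<Rightarrow> real^'m \<Rightarrow> real" where
  "dnrm g W y v = W y \<bullet> dlow g W y v + dvec W y v \<bullet> low g W y"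

lemma lowW_eq: "lowW g W y a = low g W y $ a"
  by (simp add: lowW_def low_def matrix_vector_mult_def)

lemma nrm2_eq: "nrm2 g W y = W y \<bullet> low g W y"
  by (simp add: nrm2_def low_def matrix_vector_mult_def inner_vec_def sum_distrib_left mult_ac)

lemma frak_s_eq: "frak_s g W y z = 1 - nrm2 g W y + low g W y \<bullet> (z *v tpart (g y) z (low g W y))"
proof -
  define v where "v = transpose z *v low g W y"
  have v: "(\<Sum>a\<in>UNIV. lowW g W y a * z $ a $ i) = v $ i" for i
    by (simp add: v_def lowW_eq matrix_vector_mult_def transpose_def mult.commute)
  have "(\<Sum>i\<in>UNIV. \<Sum>j\<in>UNIV. matrix_inv (hmat (g y) z) $ i $ j * v $ i * v $ j) = v \<bullet> (cometric (g y) z *v v)"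
    by (simp add: cometric_def inner_vec_def matrix_vector_mult_def sum_distrib_left mult_ac)
  also have "\<dots> = low g W y \<bullet> (z *v tpart (g y) z (low g W y))"
    by (simp add: v_def inner_matrix_left tpart_def Amat_def matrix_vector_mul_assoc)
  finally show ?thesis unfolding frak_s_def v by simp
qed

subsection \<open>Christoffel symbols\<close>

text \<open>The connection matrix of a fixed direction e: the covariant derivative of a vector along
  e is its coordinate derivative plus this matrix applied to it.\<close>

definition christoffel_mat :: "(real^'k \<Rightarrow> real^'k^'k) \<Rightarrow> real^'k \<Rightarrow> 'k::finite \<Rightarrow> real^'k^'k" where
  "christoffel_mat g y e = (\<chi> a b. christoffel g y a e b)"

lemma dx_eq_dmat: "dx (\<lambda>u. g u $ a $ b) e y = dmat g y (axis e 1) $ a $ b"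
  by (simp add: dx_def dmat_def)

lemma lower_christoffel_mat:
  assumes "invertible (g y)"
  shows "(g y ** christoffel_mat g y e) $ a $ b = 1/2 * (dmat g y (axis e 1) $ a $ b
     + dmat g y (axis b 1) $ a $ e - dmat g y (axis a 1) $ e $ b)"
proof -
  define D where "D = (\<chi> d b. 1/2 * (dmat g y (axis e 1) $ d $ b
     + dmat g y (axis b 1) $ d $ e - dmat g y (axis d 1) $ e $ b))"
  have "christoffel_mat g y e = matrix_inv (g y) ** D"
    by (simp add: vec_eq_iff christoffel_mat_def christoffel_def dx_eq_dmat D_def matrix_matrix_mult_def sum_distrib_left mult_ac)
  then have "g y ** christoffel_mat g y e = D"
    using assms by (simp add: matrix_mul_assoc matrix_inv_right)
  then show ?thesis by (simp add: D_def)
qed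

lemma christoffel_mat_commute:
  assumes "\<And>v. transpose (dmat g y v) = dmat g y v"
  shows "christoffel_mat g y e $ a $ b = christoffel_mat g y b $ a $ e"
proof -
  have d: "dmat g y v $ a $ b = dmat g y v $ b $ a" for v a b
    by (rule symmetric_entries[OF assms])
  have "christoffel g y a e b = christoffel g y a b e"
    unfolding christoffel_def dx_eq_dmat d[of _ e b] by (simp only: add.commute)
  then show ?thesis by (simp add: christoffel_mat_def)
qed

text \<open>The Levi-Civita connection is metric. In this form the coordinate derivative of the
  metric is exactly an orbit direction, with the connection matrix as generator.\<close>

lemma metric_compatible:
  assumes "invertible (g y)" "transpose (g y) = g y" and "\<And>v. transpose (dmat g y v) = dmat g y v"
  shows "dmat g y (axis e 1) = g y ** christoffel_mat g y e + transpose (christoffel_mat g y e) ** g y"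
proof -
  have d: "dmat g y v $ a $ b = dmat g y v $ b $ a" for v a b
    by (rule symmetric_entries[OF assms(3)])
  have t: "transpose (christoffel_mat g y e) ** g y = transpose (g y ** christoffel_mat g y e)"
    by (simp add: matrix_transpose_mul assms(2))
  have "dmat g y (axis e 1) $ a $ b = (g y ** christoffel_mat g y e) $ a $ b + (g y ** christoffel_mat g y e) $ b $ a" for a b
    unfolding lower_christoffel_mat[of g y, OF assms(1)]
    using d[of "axis e 1" b a] d[of "axis a 1" b e] d[of "axis b 1" e a] by (simp add: field_simps)
  moreover have "transpose N $ a $ b = N $ b $ a" for N :: "real^'a^'a" and a b
    by (simp add: transpose_def)
  ultimately show ?thesis
    unfolding t vec_eq_iff by (simp only: vector_add_component simp_thms)
qed

subsection \<open>Derivatives of the integrand\<close>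

locale navigation =
  fixes V :: "(real^'m) set" and g :: "real^'m \<Rightarrow> real^'m^'m" and W :: "real^'m \<Rightarrow> real^'m"
  assumes openV: "open V" and riem: "riemannian_on V g"
    and smoothW: "\<And>a. smooth_on V (\<lambda>y. W y $ a)" and small: "\<And>y. y \<in> V \<Longrightarrow> nrm2 g W y < 1"
begin

lemma smooth_metric: "smooth_on V (\<lambda>y. g y $ a $ b)"
  using riem by (simp add: riemannian_on_def)

lemma symmetric_metric: "y \<in> V \<Longrightarrow> transpose (g y) = g y"
  using riem by (simp add: riemannian_on_def transpose_def vec_eq_iff)

lemma positive_metric: "y \<in> V \<Longrightarrow> v \<noteq> 0 \<Longrightarrow> v \<bullet> (g y *v v) > 0"
proof -
  assume "y \<in> V" "v \<noteq> 0"
  then have "(\<Sum>a\<in>UNIV. \<Sum>b\<in>UNIV. g y $ a $ b * v $ a * v $ b) > 0"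
    using riem by (simp add: riemannian_on_def)
  then show ?thesis
    by (simp add: matrix_vector_mult_def inner_vec_def sum_distrib_left mult_ac)
qed

lemma invertible_metric: "y \<in> V \<Longrightarrow> invertible (g y)"
  using det_pos_of_positive_definite[of "g y"] positive_metric by (simp add: invertible_det_nz)

lemma line_in_V: "y \<in> V \<Longrightarrow> eventually (\<lambda>t. y + t *\<^sub>R v \<in> V) (nhds 0)"
proof -
  assume y: "y \<in> V"
  have "isCont (\<lambda>t. y + t *\<^sub>R v) 0" by (intro continuous_intros)
  then show ?thesis
    using y openV by (auto simp: continuous_at eventually_nhds_conv_at intro: topological_tendstoD)
qed

lemma sym_dmat: assumes y: "y \<in> V" shows "transpose (dmat g y v) = dmat g y v"
proof -
  have D: "((\<lambda>t. g (y + t *\<^sub>R v)) has_vector_derivative dmat g y v) (at 0)"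
    using dmat_curve[OF smooth_metric has_vector_derivative_line[of y v 0]] y by simp
  \<comment> \<open>The metric is symmetric at points of V, so the line and its transpose are
    compared near 0 only.\<close>
  have "eventually (\<lambda>t. t \<in> UNIV \<longrightarrow> g (y + t *\<^sub>R v) = transpose (g (y + t *\<^sub>R v))) (nhds 0)"
    using line_in_V[OF y, of v] by eventually_elim (simp add: symmetric_metric)
  from has_vector_derivative_cong_ev[OF this, of "dmat g y v"] D y
  have "((\<lambda>t. transpose (g (y + t *\<^sub>R v))) has_vector_derivative dmat g y v) (at 0)"
    by (simp add: symmetric_metric)
  with transpose_has_vector_derivative[OF D] show ?thesis
    using vector_derivative_unique_at by blast
qed

lemma nondegenerate: "y \<in> V \<Longrightarrow> det (hmat (g y) z) > 0 \<Longrightarrow> nondegenerate (g y) z"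
  by unfold_locales (auto simp: symmetric_metric invertible_det_nz)

lemma variation_line:
  assumes y: "y \<in> V" and d: "det (hmat (g y) z) > 0"
  shows "variation (\<lambda>t. g (y + t *\<^sub>R v)) (\<lambda>t. z + t *\<^sub>R Z) (\<lambda>t. low g W (y + t *\<^sub>R v))
    (\<lambda>t. nrm2 g W (y + t *\<^sub>R v)) (dmat g y v) (dlow g W y v) (dnrm g W y v) Z 0"
proof -
  have G: "((\<lambda>t. g (y + t *\<^sub>R v)) has_vector_derivative dmat g y v) (at 0)"
    using dmat_curve[OF smooth_metric has_vector_derivative_line[of y v 0]] y by simp
  have W: "((\<lambda>t. W (y + t *\<^sub>R v)) has_vector_derivative dvec W y v) (at 0)"
    using dvec_curve[OF smoothW has_vector_derivative_line[of y v 0]] y by simp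
  have l: "((\<lambda>t. low g W (y + t *\<^sub>R v)) has_vector_derivative dlow g W y v) (at 0)"
    using matrix_vector_mult_has_vector_derivative[OF G W] by (simp add: low_def dlow_def)
  have n: "((\<lambda>t. nrm2 g W (y + t *\<^sub>R v)) has_real_derivative dnrm g W y v) (at 0)"
    using inner_has_vector_derivative[OF W l]
    by (simp add: nrm2_eq dnrm_def has_real_derivative_iff_has_vector_derivative)
  show ?thesis
    unfolding variation_def
    using G l n has_vector_derivative_line nondegenerate[OF y d] sym_dmat[OF y] by simp
qed

text \<open>The conditions under which the integrand can be differentiated. They survive small moves
  along any line, which is what a second differentiation requires.\<close>

definition admissible :: "real^'m \<Rightarrow> real^'n^'m \<Rightarrow> bool" where
  "admissible y z \<longleftrightarrow> y \<in> V \<and> det (hmat (g y) z) > 0 \<and> frak_s g W y z > 0"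

lemma eventually_admissible:
  assumes "admissible y z"
  shows "eventually (\<lambda>t. admissible (y + t *\<^sub>R v) (z + t *\<^sub>R Z)) (nhds 0)"
proof -
  have y: "y \<in> V" and d: "det (hmat (g y) z) > 0" and s: "frak_s g W y z > 0"
    using assms by (auto simp: admissible_def)
  interpret variation "\<lambda>t. g (y + t *\<^sub>R v)" "\<lambda>t. z + t *\<^sub>R Z" "\<lambda>t. low g W (y + t *\<^sub>R v)"
    "\<lambda>t. nrm2 g W (y + t *\<^sub>R v)" "dmat g y v" "dlow g W y v" "dnrm g W y v" Z 0
    by (rule variation_line[OF y d])
  have "isCont (\<lambda>t. det (hmat (g (y + t *\<^sub>R v)) (z + t *\<^sub>R Z))) 0"
    using det_has_derivative[OF hmat_has_vector_derivative inv] by (rule DERIV_isCont)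
  then have "eventually (\<lambda>t. det (hmat (g (y + t *\<^sub>R v)) (z + t *\<^sub>R Z)) > 0) (nhds 0)"
    using d by (auto simp: continuous_at eventually_nhds_conv_at intro: order_tendstoD(1))
  moreover have "isCont (\<lambda>t. frak_s g W (y + t *\<^sub>R v) (z + t *\<^sub>R Z)) 0"
    unfolding frak_s_eq using s_has_real_derivative by (rule DERIV_isCont)
  then have "eventually (\<lambda>t. frak_s g W (y + t *\<^sub>R v) (z + t *\<^sub>R Z) > 0) (nhds 0)"
    using s by (auto simp: continuous_at eventually_nhds_conv_at intro: order_tendstoD(1))
  ultimately show ?thesis
    using line_in_V[OF y, of v] unfolding admissible_def by eventually_elim simp
qed

definition vol :: "volform \<Rightarrow> real^'m \<Rightarrow> real^'n^'m \<Rightarrow> real" where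
  "vol vt y z = sqrt (det (hmat (g y) z)) / chi vt CARD('n) (nrm2 g W y)"

lemma pd_Fcal:
  fixes z :: "real^'n^'m" and vt :: volform
  assumes "admissible y z"
  defines "s \<equiv> frak_s g W y z" and "L \<equiv> deriv (\<lambda>w. ln (chi vt CARD('n) w)) (nrm2 g W y)"
  shows "pd (Fcal vt g W) (v, Z) (y, z) = vol vt y z *
     ((var_vol (g y) z (dmat g y v) Z - L * dnrm g W y v) * rho vt CARD('n) s
      + deriv (rho vt CARD('n)) s * var_s (g y) z (low g W y) (dmat g y v) (dlow g W y v) (dnrm g W y v) Z)"
    and "((\<lambda>t. vol vt (y + t *\<^sub>R v) (z + t *\<^sub>R Z) * first_var (rho vt CARD('n) (frak_s g W (y + t *\<^sub>R v) (z + t *\<^sub>R Z)))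
        (deriv (rho vt CARD('n)) (frak_s g W (y + t *\<^sub>R v) (z + t *\<^sub>R Z))) (g (y + t *\<^sub>R v)) (z + t *\<^sub>R Z) (low g W (y + t *\<^sub>R v)) Y)
      has_real_derivative vol vt y z * second_var (rho vt CARD('n) s) (deriv (rho vt CARD('n)) s)
        (deriv (deriv (rho vt CARD('n))) s) L (g y) z (low g W y) (dmat g y v) (dlow g W y v) (dnrm g W y v) Z Y) (at 0)"
proof -
  have y: "y \<in> V" and d: "det (hmat (g y) z) > 0" and s: "frak_s g W y z > 0"
    using assms by (auto simp: admissible_def)
  interpret variation "\<lambda>t. g (y + t *\<^sub>R v)" "\<lambda>t. z + t *\<^sub>R Z" "\<lambda>t. low g W (y + t *\<^sub>R v)"
    "\<lambda>t. nrm2 g W (y + t *\<^sub>R v)" "dmat g y v" "dlow g W y v" "dnrm g W y v" Z 0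
    by (rule variation_line[OF y d])
  note D = first_var_has_real_derivative[of s "rho vt CARD('n)" "deriv (rho vt CARD('n))" 
      "deriv (deriv (rho vt CARD('n))) s" "chi vt CARD('n)" L]
  have 1: "s = 1 - nrm2 g W (y + 0 *\<^sub>R v) + low g W (y + 0 *\<^sub>R v) \<bullet>
      ((z + 0 *\<^sub>R Z) *v tpart (g (y + 0 *\<^sub>R v)) (z + 0 *\<^sub>R Z) (low g W (y + 0 *\<^sub>R v)))"
    by (simp add: s_def frak_s_eq)
  have 2: "det (hmat (g (y + 0 *\<^sub>R v)) (z + 0 *\<^sub>R Z)) > 0" using d by simp
  have 3: "(chi vt CARD('n) has_real_derivative chi vt CARD('n) (nrm2 g W (y + 0 *\<^sub>R v)) * L) (at (nrm2 g W (y + 0 *\<^sub>R v)))"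
    "chi vt CARD('n) (nrm2 g W (y + 0 *\<^sub>R v)) > 0"
    using chi_derivative[OF small[OF y], of vt "CARD('n)"] by (simp_all add: L_def)
  have r: "(rho vt CARD('n) has_real_derivative deriv (rho vt CARD('n)) s) (at s)"
    "(deriv (rho vt CARD('n)) has_real_derivative deriv (deriv (rho vt CARD('n))) s) (at s)"
    using rho_derivatives[OF s] by (simp_all add: s_def)
  have "((\<lambda>t. Fcal vt g W ((y, z) + t *\<^sub>R (v, Z))) has_real_derivative vol vt y z *
     ((var_vol (g y) z (dmat g y v) Z - L * dnrm g W y v) * rho vt CARD('n) s
      + deriv (rho vt CARD('n)) s * var_s (g y) z (low g W y) (dmat g y v) (dlow g W y v) (dnrm g W y v) Z)) (at 0)"
    using D(1)[OF 1 r 2 3] by (simp add: Fcal_def frak_s_eq vol_def)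
  then show "pd (Fcal vt g W) (v, Z) (y, z) = vol vt y z *
     ((var_vol (g y) z (dmat g y v) Z - L * dnrm g W y v) * rho vt CARD('n) s
      + deriv (rho vt CARD('n)) s * var_s (g y) z (low g W y) (dmat g y v) (dlow g W y v) (dnrm g W y v) Z)"
    unfolding pd_def by (rule DERIV_imp_deriv)
  show "((\<lambda>t. vol vt (y + t *\<^sub>R v) (z + t *\<^sub>R Z) * first_var (rho vt CARD('n) (frak_s g W (y + t *\<^sub>R v) (z + t *\<^sub>R Z)))
        (deriv (rho vt CARD('n)) (frak_s g W (y + t *\<^sub>R v) (z + t *\<^sub>R Z))) (g (y + t *\<^sub>R v)) (z + t *\<^sub>R Z) (low g W (y + t *\<^sub>R v)) Y)
      has_real_derivative vol vt y z * second_var (rho vt CARD('n) s) (deriv (rho vt CARD('n)) s)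
        (deriv (deriv (rho vt CARD('n))) s) L (g y) z (low g W y) (dmat g y v) (dlow g W y v) (dnrm g W y v) Z Y) (at 0)"
    using D(2)[OF 1 r 2 3, of Y] by (simp add: frak_s_eq vol_def)
qed

lemma zero_direction: "dmat g y 0 = 0" "dlow g W y 0 = 0" "dnrm g W y 0 = 0"
proof -
  show 1: "dmat g y 0 = 0" by (simp add: dmat_def pd_def vec_eq_iff)
  have 2: "dvec W y 0 = 0" by (simp add: dvec_def pd_def vec_eq_iff)
  show "dlow g W y 0 = 0" "dnrm g W y 0 = 0" by (simp_all add: dnrm_def dlow_def 1 2)
qed

lemma pd_Fcal_fibre:
  fixes z :: "real^'n^'m"
  assumes "admissible y z"
  shows "pd (Fcal vt g W) (0, Y) (y, z) = vol vt y z *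
     first_var (rho vt CARD('n) (frak_s g W y z)) (deriv (rho vt CARD('n)) (frak_s g W y z)) (g y) z (low g W y) Y"
  unfolding pd_Fcal(1)[OF assms]
  by (simp add: zero_direction first_var_def var_vol_def var_s_def matrix_distribs algebra_simps)

lemma pd_pd_Fcal:
  fixes z :: "real^'n^'m" and vt :: volform
  assumes "admissible y z"
  defines "s \<equiv> frak_s g W y z" and "L \<equiv> deriv (\<lambda>w. ln (chi vt CARD('n) w)) (nrm2 g W y)"
  shows "pd (\<lambda>r. pd (Fcal vt g W) (0, Y) r) (v, Z) (y, z) = vol vt y z * 
     second_var (rho vt CARD('n) s) (deriv (rho vt CARD('n)) s)
        (deriv (deriv (rho vt CARD('n))) s) L (g y) z (low g W y) (dmat g y v) (dlow g W y v) (dnrm g W y v) Z Y"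
proof -
  \<comment> \<open>The formula for the inner derivative holds at admissible points, so it has to be
    known on a neighbourhood before it is differentiated.\<close>
  have ev: "eventually (\<lambda>t. pd (Fcal vt g W) (0, Y) ((y, z) + t *\<^sub>R (v, Z)) = vol vt (y + t *\<^sub>R v) (z + t *\<^sub>R Z)
      * first_var (rho vt CARD('n) (frak_s g W (y + t *\<^sub>R v) (z + t *\<^sub>R Z)))
        (deriv (rho vt CARD('n)) (frak_s g W (y + t *\<^sub>R v) (z + t *\<^sub>R Z))) (g (y + t *\<^sub>R v)) (z + t *\<^sub>R Z) (low g W (y + t *\<^sub>R v)) Y) (nhds 0)"
    using eventually_admissible[OF assms(1), of v Z] by eventually_elim (simp add: pd_Fcal_fibre)
  show ?thesis
    unfolding pd_def[of "\<lambda>r. pd (Fcal vt g W) (0, Y) r"] s_def L_def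
    by (rule DERIV_imp_deriv) (rule DERIV_cong_ev[OF refl ev refl, THEN iffD2, OF pd_Fcal(2)[OF assms(1)]])
qed

end

section \<open>Covariant derivative of the field and matrix form of the target formula\<close>

definition cov_mat :: "(real^'m \<Rightarrow> real^'m^'m) \<Rightarrow> (real^'m \<Rightarrow> real^'m) \<Rightarrow> real^'m \<Rightarrow> real^'m^'m" where
  "cov_mat g W y = (\<chi> a e. covWl g W y a e)"

lemma cov_mat_axis: "cov_mat g W y *v axis e 1 = g y *v (dvec W y (axis e 1) + christoffel_mat g y e *v W y)"
  by (subst vec_eq_iff, simp only: matrix_vector_axis)
    (simp add: cov_mat_def covWl_def covW_def dx_def dvec_def christoffel_mat_def matrix_vector_mult_def)

lemma rhs_eq:
  fixes f :: "real^'n \<Rightarrow> real^'m" and g :: "real^'m \<Rightarrow> real^'m^'m" and vt :: volform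
    and W :: "real^'m \<Rightarrow> real^'m" and x :: "real^'n"
  defines "y \<equiv> f x" and "z \<equiv> Dfz f x"
  defines "s \<equiv> frak_s g W y z" and "p \<equiv> low g W y"
  defines "r0 \<equiv> rho vt CARD('n) s" and "r1 \<equiv> deriv (rho vt CARD('n)) s"
    and "r2 \<equiv> deriv (deriv (rho vt CARD('n))) s"
    and "L \<equiv> deriv (\<lambda>w. ln (chi vt CARD('n) w)) (nrm2 g W y)"
    and "\<omega> \<equiv> 2 *\<^sub>R (transpose (cov_mat g W y) *v W y)"
    and "u \<equiv> tpart (g y) z p" and "\<pi> \<equiv> npart (g y) z p" and "P \<equiv> nproj (g y) z"
  assumes nz: "r0 \<noteq> 0"
  shows "r0 * rhs vt g W f x c = 
      L * (2 * r1 * \<pi> $ c * (\<omega> \<bullet> (z *v u)) - r0 * (transpose P *v \<omega>) $ c)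
      + (2 * r2 * \<pi> $ c * (\<omega> \<bullet> (z *v u)) - r1 * (transpose P *v \<omega>) $ c)
      - 4 * r1 * (transpose P *v (cov_mat g W y *v (z *v u))) $ c
      - (\<Sum>i\<in>UNIV. \<Sum>j\<in>UNIV. \<Sum>a\<in>UNIV. (cometric (g y) z $ i $ j * (2 * r1 * p $ a * \<pi> $ c + r0 * g y $ c $ a)
        + 2 * (u $ i * u $ j) * (2 * r2 * p $ a * \<pi> $ c - r1 * g y $ c $ a)) * sff g f x a i j)"
proof -
  let ?G = "g y" and ?R = "cov_mat g W y"
  \<comment> \<open>Since \<omega> = 2 (nabla W)^T W carries the factor 2 of the gradient of a
    squared norm, the target's contraction with W_{a|e} W^a contains \<omega>/2: this removes the 2
    in front of u' and halves v'.\<close>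
  define K where "K u' v' = u' * \<pi> $ c * (\<omega> \<bullet> (z *v u)) - v' / 2 * (transpose P *v \<omega>) $ c" for u' v'
  have tP: "(transpose P *v v) $ c = (\<Sum>e\<in>UNIV. P $ e $ c * v $ e)" for v
    by (simp add: matrix_vector_mult_def transpose_def)
  have A: "(\<Sum>j\<in>UNIV. matrix_inv (hmat ?G z) $ i $ j * z $ a $ j) = Amat ?G z $ i $ a" for i a
    by (simp add: Amat_def cometric_def matrix_matrix_mult_def transpose_def)
  have B: "(\<Sum>i\<in>UNIV. \<Sum>j\<in>UNIV. matrix_inv (hmat ?G z) $ i $ j * z $ a $ i * z $ b $ j) = Bmat ?G z $ a $ b" for a b
  proof -
    have "Bmat ?G z $ a $ b = (\<Sum>i\<in>UNIV. z $ a $ i * Amat ?G z $ i $ b)"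
      by (simp add: Bmat_def matrix_matrix_mult_def)
    then show ?thesis
      unfolding A[symmetric] by (simp add: sum_distrib_left mult_ac)
  qed
  have P: "kd a b - (\<Sum>d\<in>UNIV. Bmat ?G z $ a $ d * ?G $ d $ b) = P $ a $ b" for a b
  proof -
    have "z ** coef ?G z = Bmat ?G z ** ?G" by (simp add: coef_def Bmat_def matrix_mul_assoc)
    then show ?thesis by (simp add: P_def nproj_def kd_def mat_def matrix_matrix_mult_def)
  qed
  have p: "lowW g W y = (\<lambda>a. p $ a)" by (simp add: fun_eq_iff lowW_eq p_def)
  have \<pi>: "(\<Sum>b\<in>UNIV. p $ b * P $ b $ c) = \<pi> $ c"
    by (simp add: \<pi>_def npart_def P_def matrix_vector_mult_def transpose_def mult.commute)
  have Bp: "(\<Sum>d\<in>UNIV. Bmat ?G z $ e $ d * p $ d) = (z *v u) $ e" for e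
    by (simp add: u_def tpart_def matrix_vector_mul_assoc Bmat_def[symmetric]) (simp add: matrix_vector_mult_def)
  have BWWP: "(\<Sum>d\<in>UNIV. \<Sum>t\<in>UNIV. Bmat ?G z $ e $ d * p $ d * p $ t * P $ t $ c) = (z *v u) $ e * \<pi> $ c" for e
    unfolding Bp[symmetric] \<pi>[symmetric] sum_product by (simp add: mult_ac)
  have AA: "(\<Sum>d\<in>UNIV. \<Sum>t\<in>UNIV. p $ d * p $ t * Amat ?G z $ i $ d * Amat ?G z $ j $ t) = u $ i * u $ j" for i j
    unfolding u_def tpart_def matrix_vector_mult_def by (simp add: sum_product mult_ac)
  have \<omega>: "(\<Sum>a\<in>UNIV. covWl g W y a e * W y $ a) = \<omega> $ e / 2" for e
    by (simp add: \<omega>_def cov_mat_def matrix_vector_mult_def transpose_def)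
  have K: "(\<Sum>e\<in>UNIV. \<Sum>a\<in>UNIV. (2 * u' * ((z *v u) $ e * \<pi> $ c) - v' * P $ e $ c) * covWl g W y a e * W y $ a) = K u' v'" for u' v'
  proof -
    have "(\<Sum>e\<in>UNIV. \<Sum>a\<in>UNIV. (2 * u' * ((z *v u) $ e * \<pi> $ c) - v' * P $ e $ c) * covWl g W y a e * W y $ a) =
       (\<Sum>e\<in>UNIV. (2 * u' * ((z *v u) $ e * \<pi> $ c) - v' * P $ e $ c) * (\<omega> $ e / 2))"
      unfolding \<omega>[symmetric] by (simp add: sum_distrib_left mult.assoc)
    also have "\<dots> = (\<Sum>e\<in>UNIV. u' * \<pi> $ c * (\<omega> $ e * (z *v u) $ e) - v' / 2 * (P $ e $ c * \<omega> $ e))"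
      by (intro sum.cong refl) (simp add: field_simps)
    also have "\<dots> = K u' v'"
      unfolding sum_subtractf sum_distrib_left[symmetric] K_def
      by (simp add: inner_vec_def tP)
    finally show ?thesis .
  qed
  have R: "(\<Sum>e\<in>UNIV. \<Sum>b\<in>UNIV. \<Sum>a\<in>UNIV. Bmat ?G z $ e $ b * covWl g W y a e * p $ b * P $ a $ c)
     = (transpose P *v (?R *v (z *v u))) $ c"
  proof -
    have "(\<Sum>b\<in>UNIV. \<Sum>a\<in>UNIV. Bmat ?G z $ e $ b * covWl g W y a e * p $ b * P $ a $ c) =
       (\<Sum>a\<in>UNIV. P $ a $ c * (?R $ a $ e * (z *v u) $ e))" for e
      unfolding Bp[symmetric] by (subst sum.swap) (simp add: cov_mat_def sum_distrib_left mult_ac)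
    then have "(\<Sum>e\<in>UNIV. \<Sum>b\<in>UNIV. \<Sum>a\<in>UNIV. Bmat ?G z $ e $ b * covWl g W y a e * p $ b * P $ a $ c)
       = (\<Sum>e\<in>UNIV. \<Sum>a\<in>UNIV. P $ a $ c * (?R $ a $ e * (z *v u) $ e))" by simp
    also have "\<dots> = (\<Sum>a\<in>UNIV. P $ a $ c * (?R *v (z *v u)) $ a)"
      by (subst sum.swap) (simp add: matrix_vector_mult_def[of ?R] sum_distrib_left)
    finally show ?thesis by (simp only: tP)
  qed
  have r0: "r0 * (2 * L / r0 * X - 1 / r0 * Y - 1 / r0 * Z) = 2 * L * X - Y - Z" if "r0 \<noteq> 0" for X Y Z
    using that by (simp add: field_simps)
  have rhs: "rhs vt g W f x c = 2 * L / r0 * K r1 r0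
     - 1 / r0 * (4 * r1 * (transpose P *v (?R *v (z *v u))) $ c - 2 * K r2 r1)
     - 1 / r0 * (\<Sum>i\<in>UNIV. \<Sum>j\<in>UNIV. \<Sum>a\<in>UNIV. (cometric ?G z $ i $ j * (2 * r1 * p $ a * \<pi> $ c + r0 * ?G $ c $ a)
        + 2 * (u $ i * u $ j) * (2 * r2 * p $ a * \<pi> $ c - r1 * ?G $ c $ a)) * sff g f x a i j)"
    unfolding rhs_def Let_def y_def[symmetric] z_def[symmetric] s_def[symmetric]
      r0_def[symmetric] r1_def[symmetric] r2_def[symmetric] L_def[symmetric]
      A B P p \<pi> BWWP AA K R by (simp only: cometric_def)
  show ?thesis
    unfolding rhs r0[OF nz] K_def by algebra
qed

context navigation
begin

lemma dlow_axis:
  assumes "y \<in> V"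
  shows "dlow g W y (axis e 1) = cov_mat g W y *v axis e 1 + transpose (christoffel_mat g y e) *v low g W y"
  unfolding dlow_def cov_mat_axis metric_compatible[OF invertible_metric[OF assms] symmetric_metric[OF assms] sym_dmat[OF assms]]
  by (simp add: low_def matrix_normalize)

text \<open>The Christoffel term of \<open>dlow_axis\<close>, transposed onto W, completes the
  coordinate derivative of W to the covariant one. The same pairing then occurs twice, whence the
  factor 2.\<close>

lemma dnrm_axis:
  assumes "y \<in> V"
  shows "dnrm g W y (axis e 1) = (2 *\<^sub>R (transpose (cov_mat g W y) *v W y)) $ e"
proof -
  have "W y \<bullet> (transpose (christoffel_mat g y e) *v low g W y) + dvec W y (axis e 1) \<bullet> low g W y
     = (christoffel_mat g y e *v W y + dvec W y (axis e 1)) \<bullet> low g W y"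
    by (simp add: inner_matrix_left inner_add_left)
  also have "\<dots> = W y \<bullet> (g y *v (dvec W y (axis e 1) + christoffel_mat g y e *v W y))"
    using symmetric_metric[OF assms] by (simp add: low_def inner_commute[of _ "g y *v W y"] inner_matrix_left add.commute)
  finally have "dnrm g W y (axis e 1) = 2 * (W y \<bullet> (cov_mat g W y *v axis e 1))"
    unfolding dnrm_def dlow_axis[OF assms] cov_mat_axis by (simp add: inner_add_right)
  also have "W y \<bullet> (cov_mat g W y *v axis e 1) = (transpose (cov_mat g W y) *v W y) $ e"
    using inner_matrix_left[of "transpose (cov_mat g W y)" "W y" "axis e 1"] by (simp add: inner_axis)
  finally show ?thesis by simp
qed

text \<open>The Christoffel symbols of the first kind with a and e exchanged add up to the
  derivative of g_{ae}, so W_{a|e} + W_{e|a} is the coordinate Lie derivative of the metric along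
  W.\<close>

lemma cov_mat_skew:
  assumes k: "killing_on V g W" and y: "y \<in> V"
  shows "transpose (cov_mat g W y) = - cov_mat g W y"
proof -
  have d: "dmat g y v $ a $ b = dmat g y v $ b $ a" for v a b
    by (rule symmetric_entries[OF sym_dmat[OF y]])
  have G: "g y $ a $ b = g y $ b $ a" for a b
    by (rule symmetric_entries[OF symmetric_metric[OF y]])
  have R: "cov_mat g W y $ a $ e = (\<Sum>d\<in>UNIV. g y $ a $ d * dvec W y (axis e 1) $ d + (g y ** christoffel_mat g y e) $ a $ d * W y $ d)" for a e
  proof -
    have "cov_mat g W y $ a $ e = (g y *v dvec W y (axis e 1) + (g y ** christoffel_mat g y e) *v W y) $ a"
      using matrix_vector_axis[of "cov_mat g W y" e a] unfolding cov_mat_axis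
      by (simp add: matrix_vector_right_distribs matrix_vector_mul_assoc)
    then show ?thesis
      by (simp add: matrix_vector_mult_def sum.distrib)
  qed
  have skew: "cov_mat g W y $ a $ e + cov_mat g W y $ e $ a = 0" for a e
  proof -
    have "cov_mat g W y $ a $ e + cov_mat g W y $ e $ a = (\<Sum>d\<in>UNIV. W y $ d * dx (\<lambda>u. g u $ a $ e) d y
        + g y $ d $ e * dx (\<lambda>u. W u $ d) a y + g y $ a $ d * dx (\<lambda>u. W u $ d) e y)"
      unfolding R sum.distrib[symmetric]
    proof (intro sum.cong refl)
      fix b
      have "(g y ** christoffel_mat g y e) $ a $ b + (g y ** christoffel_mat g y a) $ e $ b = dmat g y (axis b 1) $ a $ e"
        unfolding lower_christoffel_mat[of g y, OF invertible_metric[OF y]]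
        using d[of "axis b 1" e a] by (simp add: field_simps)
      then have "(g y ** christoffel_mat g y e) $ a $ b * W y $ b + (g y ** christoffel_mat g y a) $ e $ b * W y $ b = W y $ b * dmat g y (axis b 1) $ a $ e"
        unfolding distrib_right[symmetric] by (simp only: mult.commute)
      then show "g y $ a $ b * dvec W y (axis e 1) $ b + (g y ** christoffel_mat g y e) $ a $ b * W y $ b +
         (g y $ e $ b * dvec W y (axis a 1) $ b + (g y ** christoffel_mat g y a) $ e $ b * W y $ b) =
         W y $ b * dx (\<lambda>u. g u $ a $ e) b y + g y $ b $ e * dx (\<lambda>u. W u $ b) a y + g y $ a $ b * dx (\<lambda>u. W u $ b) e y"
        unfolding dx_eq_dmat by (simp add: dx_def dvec_def G[of b e])
    qed
    then show ?thesis using k y by (simp add: killing_on_def)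
  qed
  have "transpose (cov_mat g W y) $ a $ e = (- cov_mat g W y) $ a $ e" for a e
    using skew[of a e] by (simp add: transpose_def)
  then show ?thesis
    by (simp only: vec_eq_iff simp_thms)
qed

lemma admissible_immersion:
  fixes z :: "real^'n^'m"
  assumes y: "y \<in> V" and z: "\<And>v. z *v v = 0 \<Longrightarrow> v = 0"
  shows "admissible y z"
proof -
  have pos: "v \<bullet> (hmat (g y) z *v v) > 0" if "v \<noteq> 0" for v
  proof -
    have "v \<bullet> (hmat (g y) z *v v) = (z *v v) \<bullet> (g y *v (z *v v))"
      by (simp add: hmat_eq inner_matrix_left matrix_normalize)
    with positive_metric[OF y, of "z *v v"] z[of v] that show ?thesis by auto
  qed
  then have d: "det (hmat (g y) z) > 0" by (rule det_pos_of_positive_definite)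
  define v where "v = tpart (g y) z (low g W y)"
  have "hmat (g y) z *v v = transpose z *v low g W y"
    using d by (simp add: v_def tpart_def Amat_def cometric_def matrix_vector_mul_assoc matrix_mul_assoc
        matrix_inv_right invertible_det_nz)
  then have "low g W y \<bullet> (z *v v) = v \<bullet> (hmat (g y) z *v v)"
    by (simp add: inner_commute[of "low g W y"] inner_matrix_left)
  moreover have "v \<bullet> (hmat (g y) z *v v) \<ge> 0"
    using pos[of v] by (cases "v = 0") auto
  ultimately have "frak_s g W y z > 0"
    using small[OF y] by (simp add: frak_s_eq v_def)
  with y d show ?thesis by (simp add: admissible_def)
qed

end

subsection \<open>Second fundamental form\<close>

lemma dvec_eq_column_Dfz: "dvec f x (axis i 1) = column i (Dfz f x)"
  by (simp add: dvec_def column_def Dfz_def dx_def)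

lemma dmat_Dfz: "dmat (Dfz f) x (axis i 1) $ a $ j = d2f f x a i j"
  by (simp add: dmat_def Dfz_def d2f_def dx_def)

lemma d2f_commute:
  assumes "smooth_on U (\<lambda>x. f x $ a)" "x \<in> U"
  shows "d2f f x a i j = d2f f x a j i"
  unfolding d2f_def dx_def using pd_commute[OF assms] by (simp add: eta_contract_eq)

context navigation
begin

text \<open>The columns of \<open>N i\<close> are the ambient covariant derivatives of the
  coordinate fields along the i-th one. Koszul's formula for the induced metric identifies h K_i
  with z^T G N_i, so subtracting z K_i from N_i removes precisely its tangential part.\<close>

lemma gauss_formula:
  fixes f :: "real^'n \<Rightarrow> real^'m"
  assumes f: "\<And>a. smooth_on U (\<lambda>x. f x $ a)" and x: "x \<in> U" and y: "f x \<in> V"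
    and d: "det (hmat (g (f x)) (Dfz f x)) > 0"
  defines "z \<equiv> Dfz f x" and "h \<equiv> \<lambda>u. hmat (g (f u)) (Dfz f u)"
  defines "\<tau> \<equiv> \<lambda>i. (\<chi> a j. sff g f x a i j) :: real^'n^'m"
  shows "dmat (Dfz f) x (axis i 1) = \<tau> i - (\<Sum>e\<in>UNIV. z $ e $ i *\<^sub>R christoffel_mat g (f x) e) ** z + z ** christoffel_mat h x i"
    and "christoffel_mat h x i $ k $ j = christoffel_mat h x j $ k $ i"
    and "transpose (\<tau> i) ** (g (f x) ** z) = 0"
    and "\<tau> i $ a $ j = \<tau> j $ a $ i"
proof -
  let ?G = "g (f x)"
  define M where "M i = (\<Sum>e\<in>UNIV. z $ e $ i *\<^sub>R christoffel_mat g (f x) e)" for i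
  define N where "N i = dmat (Dfz f) x (axis i 1) + M i ** z" for i
  have sG: "transpose ?G = ?G" by (rule symmetric_metric[OF y])
  have hx: "h x = transpose z ** (?G ** z)" by (simp add: h_def z_def hmat_eq matrix_mul_assoc)
  have comm: "christoffel_mat g (f x) d $ a $ t = christoffel_mat g (f x) t $ a $ d" for d a t
    by (rule christoffel_mat_commute[OF sym_dmat[OF y]])
  have Mz: "(M i ** z) $ a $ j = (\<Sum>t\<in>UNIV. \<Sum>d\<in>UNIV. christoffel g (f x) a t d * z $ t $ j * z $ d $ i)" for i j a
  proof -
    have "(M i ** z) $ a $ j = (\<Sum>t\<in>UNIV. \<Sum>d\<in>UNIV. christoffel_mat g (f x) d $ a $ t * z $ t $ j * z $ d $ i)"
      by (simp add: M_def matrix_matrix_mult_def sum_distrib_left mult_ac)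
    also have "\<dots> = (\<Sum>t\<in>UNIV. \<Sum>d\<in>UNIV. christoffel_mat g (f x) t $ a $ d * z $ t $ j * z $ d $ i)"
      by (intro sum.cong refl, subst comm) (rule refl)
    finally show ?thesis by (simp add: christoffel_mat_def)
  qed
  have \<tau>N: "\<tau> i = N i - z ** christoffel_mat h x i" for i
    by (simp add: \<tau>_def N_def vec_eq_iff sff_def dmat_Dfz Mz z_def[symmetric] h_def[symmetric])
      (simp add: matrix_matrix_mult_def christoffel_mat_def mult.commute)
  then show "dmat (Dfz f) x (axis i 1) = \<tau> i - (\<Sum>e\<in>UNIV. z $ e $ i *\<^sub>R christoffel_mat g (f x) e) ** z + z ** christoffel_mat h x i"
    by (simp add: N_def M_def)
  have symN: "N i $ a $ j = N j $ a $ i" for i j a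
  proof -
    have "(M i ** z) $ a $ j = (M j ** z) $ a $ i"
      unfolding Mz by (subst sum.swap) (use comm in \<open>simp add: christoffel_mat_def mult_ac\<close>)
    then show ?thesis
      by (simp add: N_def dmat_Dfz d2f_commute[OF f x, of _ i j])
  qed
  have dGz: "dmat g (f x) (column i z) = ?G ** M i + transpose (M i) ** ?G" for i
  proof -
    have "column i z = (\<Sum>e\<in>UNIV. z $ e $ i *\<^sub>R axis e 1)"
      using sum_axis[of "column i z"] by (simp add: column_def)
    then have "dmat g (f x) (column i z) = (\<Sum>e\<in>UNIV. z $ e $ i *\<^sub>R dmat g (f x) (axis e 1))"
      using dmat_linear[OF smooth_metric y] by (simp add: linear_sum linear_scale)
    also have "\<dots> = ?G ** M i + transpose (M i) ** ?G"
      unfolding metric_compatible[OF invertible_metric[OF y] sG sym_dmat[OF y]]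
      by (simp add: M_def scaleR_right_distrib sum.distrib
          bounded_bilinear.sum_right[OF bounded_bilinear_matrix_mult]
          bounded_bilinear.sum_left[OF bounded_bilinear_matrix_mult]
          bounded_bilinear.scaleR_right[OF bounded_bilinear_matrix_mult]
          bounded_bilinear.scaleR_left[OF bounded_bilinear_matrix_mult]
          linear_sum[OF bounded_linear.linear[OF bounded_linear_transpose]] transpose_scalar)
    finally show ?thesis .
  qed
  have dh: "dmat h x (axis i 1) = transpose (N i) ** (?G ** z) + transpose (transpose (N i) ** (?G ** z))" for i
  proof -
    let ?Z = "dmat (Dfz f) x (axis i 1)"
    have "((\<lambda>t. f (x + t *\<^sub>R axis i 1)) has_vector_derivative column i z) (at 0)"
      using dvec_curve[OF f has_vector_derivative_line[of x "axis i 1" 0]] x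
      by (simp add: dvec_eq_column_Dfz z_def)
    from dmat_curve[OF smooth_metric this]
    have 1: "((\<lambda>t. g (f (x + t *\<^sub>R axis i 1))) has_vector_derivative dmat g (f x) (column i z)) (at 0)"
      using y by simp
    have "smooth_on U (\<lambda>u. Dfz f u $ a $ j)" for a j
      using smooth_on_pd[OF f, of a "axis j 1"] by (simp add: Dfz_def dx_def)
    from dmat_curve[OF this has_vector_derivative_line[of x "axis i 1" 0]]
    have 2: "((\<lambda>t. Dfz f (x + t *\<^sub>R axis i 1)) has_vector_derivative ?Z) (at 0)"
      using x by simp
    \<comment> \<open>The covector and the norm are set to zero, since only the derivative of the
      induced metric is wanted.\<close>
    interpret variation "\<lambda>t. g (f (x + t *\<^sub>R axis i 1))" "\<lambda>t. Dfz f (x + t *\<^sub>R axis i 1)" "\<lambda>_. 0"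
      "\<lambda>_. 0" "dmat g (f x) (column i z)" 0 0 ?Z 0
      using 1 2 nondegenerate[OF y d] sym_dmat[OF y] by unfold_locales (auto simp: nondegenerate_def)
    from hmat_has_vector_derivative
    have "dmat h x (axis i 1) = transpose ?Z ** (?G ** z) + transpose z ** (dmat g (f x) (column i z) ** z) + transpose z ** (?G ** ?Z)"
      unfolding h_def by (intro dmat_eqI) (simp add: z_def)
    also have "\<dots> = transpose (N i) ** (?G ** z) + transpose (transpose (N i) ** (?G ** z))"
      unfolding dGz N_def by (simp add: matrix_normalize sG)
    finally show ?thesis .
  qed
  define X where "X i j k = (transpose (N i) ** (?G ** z)) $ j $ k" for i j k
  have Xsym: "X i j k = X j i k" for i j k
    unfolding X_def by (simp add: matrix_matrix_mult_def transpose_def symN[of i _ j])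
  have dX: "dmat h x (axis i 1) $ j $ k = X i j k + X i k j" for i j k
    unfolding dh X_def by (simp add: transpose_def)
  show hcomm: "christoffel_mat h x i $ k $ j = christoffel_mat h x j $ k $ i" for i j k
  proof -
    have "christoffel h x k i j = christoffel h x k j i"
      unfolding christoffel_def dx_eq_dmat dX by (simp add: add_ac)
    then show ?thesis by (simp add: christoffel_mat_def)
  qed
  have "h x ** christoffel_mat h x i = transpose (transpose (N i) ** (?G ** z))" for i
  proof -
    have inv: "invertible (h x)" using d by (simp add: h_def invertible_det_nz)
    \<comment> \<open>Expanding the first-kind symbol gives six terms X; symmetry of X in its first
      two indices cancels four of them and makes the remaining two equal.\<close>
    have "(h x ** christoffel_mat h x i) $ k $ j = X i j k" for k j
      unfolding lower_christoffel_mat[of h x, OF inv] dX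
      using Xsym[of i k j] Xsym[of j k i] Xsym[of i j k] by (simp add: field_simps)
    then show ?thesis by (simp add: vec_eq_iff X_def) (simp add: transpose_def)
  qed
  then have "transpose z ** (?G ** \<tau> i) = 0" for i
    unfolding \<tau>N by (simp add: matrix_normalize sG hx)
  from arg_cong[OF this, of transpose] show "transpose (\<tau> i) ** (?G ** z) = 0"
    by (simp add: matrix_normalize sG)
  show "\<tau> i $ a $ j = \<tau> j $ a $ i"
    unfolding \<tau>N by (simp add: matrix_matrix_mult_def symN[of i] hcomm[of i])
qed

end

theorem theorem2p2:
  fixes vt :: volform
    and g :: "real^'m::finite \<Rightarrow> real^'m^'m"
    and W :: "real^'m \<Rightarrow> real^'m"
    and f :: "real^'n::finite \<Rightarrow> real^'m"
    and U :: "(real^'n) set" and V :: "(real^'m) set"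
  assumes "open U" and "open V"
    and "riemannian_on V g"
    and "\<forall>a. smooth_on V (\<lambda>y. W y $ a)"
    and "\<forall>y\<in>V. nrm2 g W y < 1"
    and "killing_on V g W"
    and "\<forall>a. smooth_on U (\<lambda>x. f x $ a)"
    and "f ` U \<subseteq> V"
    and "\<forall>x\<in>U. \<forall>v. Dfz f x *v v = 0 \<longrightarrow> v = 0"
    and "x \<in> U"
  shows "meancurv vt g W f x c = rhs vt g W f x c"
proof -
  interpret navigation V g W
    using assms by unfold_locales auto
  define y z where "y = f x" and "z = Dfz f x"
  have y: "y \<in> V" using assms(8,10) by (auto simp: y_def)
  have adm: "admissible y z"
    by (rule admissible_immersion[OF y]) (use assms(9,10) in \<open>simp add: z_def\<close>)
  then have d: "det (hmat (g y) z) > 0" and s: "frak_s g W y z > 0" by (auto simp: admissible_def)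
  interpret nondegenerate "g y" z by (rule nondegenerate[OF y d])
  define r0 r1 r2 where "r0 = rho vt CARD('n) (frak_s g W y z)"
    and "r1 = deriv (rho vt CARD('n)) (frak_s g W y z)"
    and "r2 = deriv (deriv (rho vt CARD('n))) (frak_s g W y z)"
  define L where "L = deriv (\<lambda>w. ln (chi vt CARD('n) w)) (nrm2 g W y)"
  define p where "p = low g W y"
  define R where "R = cov_mat g W y"
  define \<omega> where "\<omega> = 2 *\<^sub>R (transpose R *v W y)"
  define \<tau> where "\<tau> i = ((\<chi> a j. sff g f x a i j) :: real^'n^'m)" for i
  define K where "K i = christoffel_mat (\<lambda>u. hmat (g (f u)) (Dfz f u)) x i" for i
  define Z where "Z i = dmat (Dfz f) x (axis i 1)" for i
  define S where "S e = dmat g y (axis e 1)" for e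
  define q where "q e = dlow g W y (axis e 1)" for e
  let ?SV = "second_var r0 r1 r2 L (g y) z p"
  have r0: "r0 > 0" using rho_derivatives(3)[OF s] by (simp add: r0_def)
  have vol: "vol vt y z > 0" 
    using d chi_derivative(2)[OF small[OF y], of vt "CARD('n)"] by (simp add: vol_def)
  have \<omega>: "dnrm g W y (axis e 1) = \<omega> $ e" for e
    using dnrm_axis[OF y] by (simp add: \<omega>_def R_def)
  have F: "Fcal vt g W (y, z) = r0 * vol vt y z"
    by (simp add: Fcal_def r0_def vol_def)
  have FX: "pd (Fcal vt g W) (dirX c) (y, z) = vol vt y z * ((var_vol (g y) z (S c) 0 - L * \<omega> $ c) * r0
      + r1 * var_s (g y) z p (S c) (q c) (\<omega> $ c) 0)"
    unfolding dirX_def pd_Fcal(1)[OF adm]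
    by (simp add: S_def q_def \<omega> r0_def r1_def L_def p_def)
  have FZZ: "pd (\<lambda>r. pd (Fcal vt g W) (dirZ e j) r) (dirZ c i) (y, z) =
      vol vt y z * ?SV 0 0 0 (axis c (axis i 1)) (axis e (axis j 1))" for e i j
    unfolding dirZ_def pd_pd_Fcal[OF adm]
    by (simp add: zero_direction r0_def r1_def r2_def L_def p_def)
  have FXZ: "pd (\<lambda>r. pd (Fcal vt g W) (dirZ c i) r) (dirX e) (y, z) =
      vol vt y z * ?SV (S e) (q e) (\<omega> $ e) 0 (axis c (axis i 1))" for e i
    unfolding dirZ_def dirX_def pd_pd_Fcal[OF adm]
    by (simp add: S_def q_def \<omega> r0_def r1_def r2_def L_def p_def)
  have smf: "smooth_on U (\<lambda>x. f x $ a)" for a using assms(7) by blast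
  note gauss = gauss_formula[OF smf assms(10), folded y_def z_def, OF y d, folded \<tau>_def K_def Z_def]
  \<comment> \<open>Since F = r0 vol, multiplying by r0 clears the denominator of H: all derivatives
    carry the same factor vol.\<close>
  have "r0 * meancurv vt g W f x c = 
      ((var_vol (g y) z (S c) 0 - L * \<omega> $ c) * r0 + r1 * var_s (g y) z p (S c) (q c) (\<omega> $ c) 0)
      - (\<Sum>i\<in>UNIV. \<Sum>j\<in>UNIV. \<Sum>e\<in>UNIV. ?SV 0 0 0 (axis c (axis i 1)) (axis e (axis j 1)) * Z i $ e $ j)
      - (\<Sum>i\<in>UNIV. \<Sum>e\<in>UNIV. ?SV (S e) (q e) (\<omega> $ e) 0 (axis c (axis i 1)) * z $ e $ i)"
  proof -
    have "r0 * (1 / (r0 * v) * (v * X - v * Y - v * T)) = X - Y - T" if "v > 0" for v X Y T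
      using that r0 by (simp add: field_simps)
    from this[OF vol] show ?thesis
      unfolding meancurv_def Let_def y_def[symmetric] z_def[symmetric] F FX FZZ FXZ
      by (simp add: mult.assoc sum_distrib_left[symmetric] Z_def dmat_Dfz)
  qed
  also have "\<dots> = (- L * \<omega> $ c * r0 + r1 * (2 * ((R *v axis c 1) \<bullet> (z *v tpart (g y) z p)) - \<omega> $ c)
      - (\<Sum>i\<in>UNIV. ?SV 0 (R *v column i z) (\<omega> \<bullet> column i z) 0 (axis c (axis i 1))))
      - (\<Sum>i\<in>UNIV. ?SV 0 0 0 (\<tau> i) (axis c (axis i 1)))"
  proof (rule euler_lagrange_reduction)
    show "christoffel_mat g y e $ a $ b = christoffel_mat g y b $ a $ e" for e b a
      by (rule christoffel_mat_commute[OF sym_dmat[OF y]])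
    show "K i $ k $ j = K j $ k $ i" for i j k by (rule gauss(2))
    show "S e = g y ** christoffel_mat g y e + transpose (christoffel_mat g y e) ** g y" for e
      unfolding S_def by (rule metric_compatible[OF invertible_metric[OF y] symmetric_metric[OF y] sym_dmat[OF y]])
    show "q e = R *v axis e 1 + transpose (christoffel_mat g y e) *v p" for e
      unfolding q_def R_def p_def by (rule dlow_axis[OF y])
    show "Z i = \<tau> i - (\<Sum>e\<in>UNIV. z $ e $ i *\<^sub>R christoffel_mat g y e) ** z + z ** K i" for i
      by (rule gauss(1))
  qed
  also have "\<dots> = r0 * rhs vt g W f x c"
  proof -
    have "transpose R = - R" unfolding R_def by (rule cov_mat_skew[OF assms(6) y])
    note sk = skew_part[OF this, of L \<omega> c r0 r1 p r2]
    note nm = normal_part[of \<tau>, OF gauss(3) gauss(4), of r0 r1 r2 L p c]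
    have "rho vt CARD('n) (frak_s g W (f x) (Dfz f x)) \<noteq> 0"
      using r0 by (simp add: r0_def y_def z_def)
    note rh = rhs_eq[OF this, of c, folded y_def z_def, folded r0_def r1_def r2_def L_def p_def R_def, folded \<omega>_def]
    show ?thesis
      unfolding sk nm rh by (simp add: \<tau>_def)
  qed
  finally show ?thesis using r0 by simp
qed

end
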